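(* Let $p>3$ be a prime, and let $f\colon\mathbb F_p^2\to\mathbb C$ be a nonzero function. Write $S:=\operatorname{supp} f\subseteq\mathbb F_p^2$ and $X:=\operatorname{supp}\hat f\subseteq\widehat{\mathbb F_p^2}$. Then $$|S||X|\ge3p(p-2),$$ unless either $\min\{|S|,|X|\}\le2$, or the smallest of the sets $S$ and $X$ is a coset of a nonzero subgroup of the corresponding group, possibly with one element missing, and the largest is either a coset, or a union of two cosets, of the orthogonal subgroup.
   Context: $\mathbb F_p^2$ is regarded as an additive group $G$; $\widehat G$ is its group of complex characters. For $f\colon G\to\mathbb C$, the Fourier transform $\hat f\colon\widehat G\to\mathbb C$ is $\hat f(\chi)=\frac1{|G|}\sum_{g\in G}f(g)\overline{\chi(g)}$. The corresponding group is $\mathbb F_p^2$ for $S$ and $\widehat{\mathbb F_p^2}$ for $X$. For a subgroup $H\le G$, the orthogonal subgroup is $H^\perp:=\{\chi\in\widehat G\colon H\le\ker\chi\}\le\widehat G$; for a subgroup $F\le\widehat G$, the orthogonal subgroup is $F^\perp:=\bigcap_{\chi\in F}\ker\chi\le G$. The support $\operatorname{supp}$ of a function is the set of points where it is nonzero. *)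

theory Defs
  imports
    Complex_Main
    "HOL-Library.Product_Plus"
    "HOL-Algebra.Coset"
    "Berlekamp_Zassenhaus.Finite_Field"
begin

definition additive_group :: "'a::ab_group_add monoid" where
  "additive_group = \<lparr>carrier = UNIV, monoid.mult = (+), one = 0\<rparr>"

definition complex_units :: "complex monoid" where
  "complex_units = \<lparr>carrier = UNIV - {0}, monoid.mult = (*), one = 1\<rparr>"

text \<open>
  As the carrier of \<^const>\<open>additive_group\<close> is the whole type, distinct functions in
  \<^const>\<open>hom\<close> are distinct characters; no extensionality condition is needed.
\<close>
definition dual_group :: "('a::ab_group_add \<Rightarrow> complex) monoid" where
  "dual_group =
    \<lparr>carrier = hom additive_group complex_units,
     monoid.mult = (\<lambda>\<psi> \<xi> g. \<psi> g * \<xi> g), one = (\<lambda>_. 1)\<rparr>"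

definition fourier :: "('a::{finite, ab_group_add} \<Rightarrow> complex) \<Rightarrow> ('a \<Rightarrow> complex) \<Rightarrow> complex" where
  "fourier f \<psi> = 1 / of_nat CARD('a) * (\<Sum>g\<in>UNIV. f g * cnj (\<psi> g))"

definition perp :: "'a::ab_group_add set \<Rightarrow> ('a \<Rightarrow> complex) set" where
  "perp H = {\<psi> \<in> carrier dual_group. H \<subseteq> kernel additive_group complex_units \<psi>}"

definition dual_perp :: "('a::ab_group_add \<Rightarrow> complex) set \<Rightarrow> 'a set" where
  "dual_perp F = (\<Inter>\<psi>\<in>F. kernel additive_group complex_units \<psi>)"

definition coset_upto_one_missing :: "('g, 'm) monoid_scheme \<Rightarrow> 'g set \<Rightarrow> 'g set \<Rightarrow> bool" where
  "coset_upto_one_missing G H A \<longleftrightarrow> (\<exists>C \<in> rcosets\<^bsub>G\<^esub> H. A = C \<or> (\<exists>c \<in> C. A = C - {c}))"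

definition one_or_two_cosets :: "('g, 'm) monoid_scheme \<Rightarrow> 'g set \<Rightarrow> 'g set \<Rightarrow> bool" where
  "one_or_two_cosets G H A \<longleftrightarrow>
    A \<in> rcosets\<^bsub>G\<^esub> H \<or> (\<exists>C \<in> rcosets\<^bsub>G\<^esub> H. \<exists>D \<in> rcosets\<^bsub>G\<^esub> H. C \<noteq> D \<and> A = C \<union> D)"

lemma comm_group_additive_group: "comm_group (additive_group :: 'a::ab_group_add monoid)"
proof (rule comm_groupI)
  fix x :: 'a
  assume "x \<in> carrier additive_group"
  show "\<exists>y\<in>carrier additive_group. y \<otimes>\<^bsub>additive_group\<^esub> x = \<one>\<^bsub>additive_group\<^esub>"
    by (rule bexI[of _ "- x"]) (auto simp: additive_group_def)
qed (auto simp: additive_group_def add_ac)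

lemma mem_dual_group_iff:
  "\<psi> \<in> carrier dual_group \<longleftrightarrow> (\<forall>x. \<psi> x \<noteq> 0) \<and> (\<forall>x y. \<psi> (x + y) = \<psi> x * \<psi> y)"
  by (auto simp: dual_group_def additive_group_def complex_units_def hom_def)

lemma mem_perp_iff: "\<psi> \<in> perp H \<longleftrightarrow> \<psi> \<in> carrier dual_group \<and> (\<forall>h\<in>H. \<psi> h = 1)"
  by (auto simp: perp_def kernel_def additive_group_def complex_units_def)

lemma mult_dual_group [simp]: "\<psi> \<otimes>\<^bsub>dual_group\<^esub> \<xi> = (\<lambda>g. \<psi> g * \<xi> g)"
  and one_dual_group [simp]: "\<one>\<^bsub>dual_group\<^esub> = (\<lambda>_. 1)"
  by (simp_all add: dual_group_def)

lemma comm_group_dual_group: "comm_group (dual_group :: ('a::ab_group_add \<Rightarrow> complex) monoid)"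
proof (rule comm_groupI)
  fix \<psi> :: "'a \<Rightarrow> complex"
  assume "\<psi> \<in> carrier dual_group"
  then show "\<exists>\<xi>\<in>carrier dual_group. \<xi> \<otimes>\<^bsub>dual_group\<^esub> \<psi> = \<one>\<^bsub>dual_group\<^esub>"
    by (intro bexI[of _ "\<lambda>g. inverse (\<psi> g)"]) (auto simp: mem_dual_group_iff fun_eq_iff)
qed (auto simp: mem_dual_group_iff mult_ac)

lemma subgroup_perp: "subgroup (perp H) (dual_group :: ('a::ab_group_add \<Rightarrow> complex) monoid)"
proof -
  interpret comm_group "dual_group :: ('a \<Rightarrow> complex) monoid"
    by (rule comm_group_dual_group)
  show ?thesis
  proof (rule subgroupI)
    have "(\<lambda>_. 1) \<in> perp H"
      by (simp add: mem_perp_iff mem_dual_group_iff)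
    then show "perp H \<noteq> {}" by blast
  next
    fix \<psi> assume \<psi>: "\<psi> \<in> perp H"
    then have "(\<lambda>g. inverse (\<psi> g)) \<in> perp H"
      by (simp add: mem_perp_iff mem_dual_group_iff)
    moreover have "inv\<^bsub>dual_group\<^esub> \<psi> = (\<lambda>g. inverse (\<psi> g))"
      using \<psi> by (intro inv_equality) (auto simp: mem_perp_iff mem_dual_group_iff fun_eq_iff)
    ultimately show "inv\<^bsub>dual_group\<^esub> \<psi> \<in> perp H" by simp
  qed (auto simp: mem_perp_iff mem_dual_group_iff)
qed

lemma subgroup_dual_perp:
  assumes "F \<subseteq> carrier dual_group"
  shows "subgroup (dual_perp F) (additive_group :: 'a::ab_group_add monoid)"
proof (cases "F = {}")
  case True
  then show ?thesis
    using group.subgroup_self[OF comm_group.axioms(2)[OF comm_group_additive_group]]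
    by (simp add: dual_perp_def additive_group_def)
next
  case False
  have "subgroup (kernel additive_group complex_units \<psi>) additive_group" if "\<psi> \<in> F" for \<psi>
  proof -
    have "group complex_units"
      by (rule groupI) (auto simp: complex_units_def intro!: bexI[of _ "inverse x" for x])
    then have "group_hom additive_group complex_units \<psi>"
      using that assms comm_group.axioms(2)[OF comm_group_additive_group]
      by (auto simp: group_hom_def group_hom_axioms_def dual_group_def)
    then show ?thesis by (rule group_hom.subgroup_kernel)
  qed
  then show ?thesis
    using False comm_group.axioms(2)[OF comm_group_additive_group]
    unfolding dual_perp_def
    by (intro group.subgroups_Inter) auto
qed

end

theory Submission
  imports Defs
begin

text \<open>
  Let \<open>S\<close> and \<open>X\<close> be the supports of the function and of its transform, both regarded as subsets of the plane,
  and fix a direction of lines together with the orthogonal direction in the dual plane. If \<open>S\<close> meets \<open>n\<close> lines of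
  the one direction and \<open>X\<close> meets \<open>m\<close> lines of the other, then each of these \<open>m\<close> lines contains at least
  \<open>p + 1 - n\<close> points of \<open>X\<close>, and each of the \<open>n\<close> lines contains at least \<open>p + 1 - m\<close> points of \<open>S\<close>.
  This is the uncertainty principle \<open>|supp g| + |supp g^| \<ge> p + 1\<close> for the group of order \<open>p\<close>, applied on a
  single line (\<open>uncertainty_prime_field\<close>, \<open>fibre_bound\<close>, \<open>dual_fibre_bound\<close>).

  By symmetry, and since nothing is claimed for sets of at most two points, assume \<open>3 \<le> |S| \<le> |X|\<close> and \<open>|S| |X| < 3 p (p - 2)\<close>. Then
  \<open>n (p + 1 - n) m (p + 1 - m) < 3 p (p - 2)\<close>, and for every direction this forces \<open>n = 1\<close> or \<open>n \<ge> p - 1\<close>.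
  Suppose that \<open>n \<ge> p - 1\<close> for all directions. Then \<open>S\<close> misses at most \<open>p + 1\<close> lines, pairwise
  nonparallel, and adding \<open>(p + 1) / 2\<close> points of intersection makes it a blocking set of the affine plane, a set that
  meets every line. Blocking sets have at least \<open>2 p - 1\<close> points, so \<open>|S| \<ge> 3 (p - 1) / 2\<close>
  (\<open>blocking_set_card\<close>, \<open>almost_blocking_set_card\<close>). On the other hand \<open>|S| < 2 (p - 1)\<close>,
  so in every direction some line contains exactly one point of \<open>S\<close>; hence \<open>m = p\<close>, \<open>X\<close> is itself a blocking set
  and \<open>|X| \<ge> 2 p - 1\<close>, which makes the product too large. Therefore \<open>S\<close> lies on a line, \<open>X\<close> is a union of
  lines of the dual direction, and counting gives \<open>|S| \<ge> p - 1\<close> and at most two lines (\<open>line_structure\<close>).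

  The uncertainty principle for prime order rests on Chebotarev's theorem on the minors of the Fourier matrix
  (\<open>minor_nonsingular\<close>). It is proved here without determinants and without the irreducibility of cyclotomic
  polynomials: the products of the entries of a hypothetical kernel vector with the powers of
  a primitive \<open>p\<close>-th root of unity \<open>\<zeta>\<close> generate a finitely generated group \<open>M\<close> of complex numbers with
  \<open>M = (1 - \<zeta>) M\<close>, which forces \<open>M = p M\<close> and then \<open>M = 0\<close> by Nakayama's lemma. The bound for blocking
  sets is the polynomial argument that a polynomial of degree less than \<open>2 (p - 1)\<close> sums to zero over the plane.
\<close>

section \<open>A form of Nakayama's lemma\<close>

text \<open>
  The additive subgroup of the complex numbers generated by the family \<open>e\<close> over the index set \<open>I\<close>.
\<close>
definition int_span :: "('i \<Rightarrow> complex) \<Rightarrow> 'i set \<Rightarrow> complex set" where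
  "int_span e I = range (\<lambda>c :: 'i \<Rightarrow> int. \<Sum>i\<in>I. of_int (c i) * e i)"

lemma int_span_0: "0 \<in> int_span e I"
  unfolding int_span_def by (rule image_eqI[of _ _ "\<lambda>_. 0"]) auto

lemma int_span_add:
  assumes "x \<in> int_span e I" "y \<in> int_span e I"
  shows "x + y \<in> int_span e I"
proof -
  obtain c d where "x = (\<Sum>i\<in>I. of_int (c i) * e i)" "y = (\<Sum>i\<in>I. of_int (d i) * e i)"
    using assms unfolding int_span_def by blast
  then have "x + y = (\<Sum>i\<in>I. of_int (c i + d i) * e i)"
    by (simp add: sum.distrib algebra_simps)
  then show ?thesis unfolding int_span_def by (intro image_eqI[of _ _ "\<lambda>i. c i + d i"]) auto
qed

lemma int_span_scale:
  assumes "x \<in> int_span e I"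
  shows "of_int k * x \<in> int_span e I"
proof -
  obtain c where "x = (\<Sum>i\<in>I. of_int (c i) * e i)"
    using assms unfolding int_span_def by blast
  then have "of_int k * x = (\<Sum>i\<in>I. of_int (k * c i) * e i)"
    by (simp add: sum_distrib_left mult.assoc)
  then show ?thesis unfolding int_span_def by (intro image_eqI[of _ _ "\<lambda>i. k * c i"]) auto
qed

lemma int_span_sum:
  assumes "\<And>j. j \<in> J \<Longrightarrow> h j \<in> int_span e I"
  shows "sum h J \<in> int_span e I"
  using assms by (induction J rule: infinite_finite_induct) (auto intro: int_span_0 int_span_add)

lemma int_span_base:
  assumes "finite I" "i \<in> I"
  shows "e i \<in> int_span e I"
proof -
  have "(\<Sum>j\<in>I. of_int (if j = i then 1 else 0) * e j) = (\<Sum>j\<in>I. if j = i then e j else 0)"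
    by (intro sum.cong) auto
  also have "\<dots> = e i" using assms by simp
  finally show ?thesis unfolding int_span_def
    by (intro image_eqI[of _ _ "\<lambda>j. if j = i then 1 else 0"]) auto
qed

text \<open>
  Nakayama's lemma over the integers: a finitely generated additive group \<open>M\<close> of complex numbers
  with \<open>M = p M\<close> is zero. The coefficients \<open>u i \<equiv> 1 (mod p)\<close> make the induction on the number
  of generators possible: eliminating the generator \<open>e a\<close> multiplies the remaining relations by
  another such coefficient.
\<close>
lemma nakayama_int:
  fixes p :: int and e :: "'i \<Rightarrow> complex"
  assumes "p > 1" "finite I"
    and "\<And>i. i \<in> I \<Longrightarrow> p dvd u i - 1"
    and "\<And>i. i \<in> I \<Longrightarrow> \<exists>m \<in> int_span e I. of_int (u i) * e i = of_int p * m"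
  shows "\<forall>i\<in>I. e i = 0"
  using assms(2-)
proof (induction I arbitrary: u rule: finite_induct)
  case empty
  then show ?case by simp
next
  case (insert a I)
  obtain r where r: "of_int (u a) * e a = of_int p * (\<Sum>j\<in>insert a I. of_int (r j) * e j)"
    using insert.prems(2)[of a] unfolding int_span_def by auto
  define v where "v = u a - p * r a"
  \<comment> \<open>the relation for \<open>e a\<close>, with the multiple of \<open>e a\<close> on the right moved to the left\<close>
  have ea: "of_int v * e a = of_int p * (\<Sum>j\<in>I. of_int (r j) * e j)"
    using r insert.hyps by (simp add: v_def algebra_simps)
  have vd: "p dvd v - 1"
  proof -
    have "v - 1 = (u a - 1) - p * r a" by (simp add: v_def)
    then show ?thesis using insert.prems(1)[of a] by (metis dvd_diff dvd_triv_left insertI1)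
  qed
  have I0: "\<forall>i\<in>I. e i = 0"
  proof (rule insert.IH[of "\<lambda>i. v * u i"])
    fix i assume i: "i \<in> I"
    have "v * u i - 1 = v * (u i - 1) + (v - 1)" by (simp add: algebra_simps)
    then show "p dvd v * u i - 1"
      using insert.prems(1)[of i] vd i by (metis dvd_add dvd_mult insertI2)
    obtain s where s: "of_int (u i) * e i = of_int p * (\<Sum>j\<in>insert a I. of_int (s j) * e j)"
      using insert.prems(2)[of i] i unfolding int_span_def by auto
    have "of_int (v * u i) * e i
        = of_int p * (of_int (s a) * (of_int v * e a) + of_int v * (\<Sum>j\<in>I. of_int (s j) * e j))"
      using s insert.hyps by (simp add: algebra_simps)
    also have "of_int (s a) * (of_int v * e a) + of_int v * (\<Sum>j\<in>I. of_int (s j) * e j)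
        = (\<Sum>j\<in>I. of_int (s a * p * r j + v * s j) * e j)"
      unfolding ea by (simp add: sum_distrib_left sum.distrib algebra_simps)
    finally show "\<exists>m \<in> int_span e I. of_int (v * u i) * e i = of_int p * m"
      unfolding int_span_def by (intro bexI[OF _ rangeI])
  qed
  have "v \<noteq> 0" using vd assms(1) by auto
  then have "e a = 0" using ea I0 by simp
  then show ?case using I0 by simp
qed

section \<open>Submatrices of the Fourier matrix of prime order\<close>

text \<open>
  The \<open>n\<close>-th forward difference of \<open>q\<close> is identically zero; equivalently, \<open>q\<close> is given by a
  polynomial of degree less than \<open>n\<close>.
\<close>
primrec diff_vanishes :: "nat \<Rightarrow> (nat \<Rightarrow> int) \<Rightarrow> bool" where
  "diff_vanishes 0 q \<longleftrightarrow> (\<forall>i. q i = 0)"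
| "diff_vanishes (Suc n) q \<longleftrightarrow> diff_vanishes n (\<lambda>i. q (Suc i) - q i)"

lemma diff_vanishes_add:
  "diff_vanishes n q \<Longrightarrow> diff_vanishes n r \<Longrightarrow> diff_vanishes n (\<lambda>i. q i + r i)"
proof (induction n arbitrary: q r)
  case (Suc n)
  have "diff_vanishes n (\<lambda>i. (q (Suc i) - q i) + (r (Suc i) - r i))"
    using Suc.prems by (intro Suc.IH) auto
  then show ?case by (simp add: algebra_simps)
qed auto

lemma diff_vanishes_mult_linear:
  "diff_vanishes n q \<Longrightarrow> diff_vanishes (Suc n) (\<lambda>i. (int i - b) * q i)"
proof (induction n arbitrary: q b)
  case (Suc n)
  have "diff_vanishes (Suc n) (\<lambda>i. (int i - (b - 1)) * (q (Suc i) - q i) + q i)"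
    using Suc.prems by (intro diff_vanishes_add Suc.IH) auto
  moreover have "(\<lambda>i. (int i - (b - 1)) * (q (Suc i) - q i) + q i)
      = (\<lambda>i. (int (Suc i) - b) * q (Suc i) - (int i - b) * q i)"
    by (auto simp: algebra_simps fun_eq_iff)
  ultimately have "diff_vanishes (Suc n) (\<lambda>i. (int (Suc i) - b) * q (Suc i) - (int i - b) * q i)"
    by simp
  then show ?case by (subst diff_vanishes.simps(2))
qed auto

lemma diff_vanishes_prod:
  "finite B \<Longrightarrow> diff_vanishes (Suc (card B)) (\<lambda>i. \<Prod>b\<in>B. int i - int b)"
proof (induction B rule: finite_induct)
  case (insert b B)
  then show ?case using diff_vanishes_mult_linear[OF insert.IH, of "int b"] by (simp del: diff_vanishes.simps)
qed auto

text \<open>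
  An additive group of complex numbers that is stable under multiplication by \<open>\<zeta>\<close>, that is, a
  \<open>\<int>[\<zeta>]\<close>-module. In the application \<open>\<zeta>\<close> is a \<open>p\<close>-th root of unity.
\<close>
locale root_module =
  fixes M :: "complex set" and \<zeta> :: complex
  assumes zero: "0 \<in> M"
    and add: "x \<in> M \<Longrightarrow> y \<in> M \<Longrightarrow> x + y \<in> M"
    and scale: "x \<in> M \<Longrightarrow> of_int k * x \<in> M"
    and root: "x \<in> M \<Longrightarrow> \<zeta> * x \<in> M"
begin

lemma root_power: "x \<in> M \<Longrightarrow> \<zeta> ^ k * x \<in> M"
  by (induction k) (auto simp: mult.assoc intro: root)

lemma sum_closed: "(\<And>i. i \<in> I \<Longrightarrow> h i \<in> M) \<Longrightarrow> sum h I \<in> M"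
  by (induction I rule: infinite_finite_induct) (auto intro: zero add)

text \<open>
  The submodule of multiples of \<open>\<pi> = 1 - \<zeta>\<close>.
\<close>
definition pi_M :: "complex set" where "pi_M = (\<lambda>m. (1 - \<zeta>) * m) ` M"

lemma pi_M_add: "x \<in> pi_M \<Longrightarrow> y \<in> pi_M \<Longrightarrow> x + y \<in> pi_M"
  unfolding pi_M_def by (auto simp flip: distrib_left intro: add)

lemma pi_M_scale: "x \<in> pi_M \<Longrightarrow> of_int k * x \<in> pi_M"
  unfolding pi_M_def by (auto simp: mult.left_commute[of _ "1 - \<zeta>"] intro: scale)

lemma pi_M_zero: "0 \<in> pi_M"
  unfolding pi_M_def using zero by force

lemma pi_M_sum: "(\<And>i. i \<in> I \<Longrightarrow> h i \<in> pi_M) \<Longrightarrow> sum h I \<in> pi_M"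
  by (induction I rule: infinite_finite_induct) (auto intro: pi_M_zero pi_M_add)

lemma one_minus_root_power: "x \<in> M \<Longrightarrow> (1 - \<zeta> ^ k) * x \<in> pi_M"
proof -
  assume x: "x \<in> M"
  have "(1 - \<zeta> ^ k) * x = (1 - \<zeta>) * (\<Sum>i<k. \<zeta> ^ i * x)"
    by (simp add: one_diff_power_eq sum_distrib_right mult.assoc)
  moreover have "(\<Sum>i<k. \<zeta> ^ i * x) \<in> M" using x by (intro sum_closed root_power)
  ultimately show ?thesis unfolding pi_M_def by (rule image_eqI)
qed

text \<open>
  If a polynomial with coefficients in \<open>M\<close> is divisible by \<open>X - \<zeta> ^ k\<close>, then the quotient has
  coefficients in \<open>M\<close> too: as the divisor is monic, they are computed from the top one downwards.
\<close>
lemma coeff_quotient: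
  assumes F: "F = [:- (\<zeta> ^ k), 1:] * Q" and M: "\<And>i. coeff F i \<in> M"
  shows "coeff Q i \<in> M"
proof (induction "Suc (degree Q) - i" arbitrary: i rule: less_induct)
  case less
  show ?case
  proof (cases "i > degree Q")
    case True
    then show ?thesis by (simp add: coeff_eq_0 zero)
  next
    case False
    have "coeff F (Suc i) = coeff Q i - \<zeta> ^ k * coeff Q (Suc i)"
      by (simp add: F mult_pCons_left)
    then have "coeff Q i = coeff F (Suc i) + \<zeta> ^ k * coeff Q (Suc i)" by simp
    moreover have "coeff Q (Suc i) \<in> M" using False by (intro less) auto
    ultimately show ?thesis using M root_power add by simp
  qed
qed

text \<open>
  Modulo \<open>\<pi>\<close> all powers of \<open>\<zeta>\<close> become \<open>1\<close>, so a polynomial over \<open>M\<close> that vanishes at \<open>n\<close>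
  distinct powers of \<open>\<zeta>\<close> is divisible by \<open>(X - 1) ^ n\<close> modulo \<open>\<pi>\<close>, and is then annihilated by
  pairing its coefficients with an integer polynomial of degree less than \<open>n\<close>. In the induction each
  linear factor \<open>X - \<zeta> ^ k\<close> of the polynomial turns \<open>q\<close> into its forward difference.
\<close>
lemma difference_functional:
  assumes "finite Z" "inj_on (\<lambda>z. \<zeta> ^ z) Z"
    and "\<And>i. coeff F i \<in> M"
    and "\<And>z. z \<in> Z \<Longrightarrow> poly F (\<zeta> ^ z) = 0"
    and "diff_vanishes (card Z) q" "degree F < N"
  shows "(\<Sum>i<N. of_int (q i) * coeff F i) \<in> pi_M"
  using assms
proof (induction Z arbitrary: F q N rule: finite_induct)
  case empty
  then show ?case using pi_M_zero by simp
next
  case (insert k Z)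
  obtain Q where Q: "F = [:- (\<zeta> ^ k), 1:] * Q"
    using insert.prems(3)[of k] by (auto simp: poly_eq_0_iff_dvd dvd_def)
  have QM: "coeff Q i \<in> M" for i using coeff_quotient[OF Q insert.prems(2)] .
  have degQ: "degree Q < N"
  proof (cases "Q = 0")
    case False
    then have "degree F = Suc (degree Q)" unfolding Q by (subst degree_mult_eq) auto
    then show ?thesis using insert.prems(5) by simp
  qed (use insert.prems(5) in auto)
  have QN: "coeff Q i = 0" if "Suc i \<ge> N" for i
  proof (cases "Q = 0")
    case False
    then have "degree F = Suc (degree Q)" unfolding Q by (subst degree_mult_eq) auto
    then show ?thesis using insert.prems(5) that by (intro coeff_eq_0) auto
  qed auto
  obtain N' where N': "N = Suc N'" using insert.prems(5) by (cases N) auto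
  \<comment> \<open>summation by parts, with \<open>coeff F i = coeff Q (i - 1) - \<zeta> ^ k * coeff Q i\<close>\<close>
  have "(\<Sum>i<N. of_int (q i) * coeff F i)
      = (\<Sum>i<N. of_int (q i) * (case i of 0 \<Rightarrow> 0 | Suc j \<Rightarrow> coeff Q j))
        - \<zeta> ^ k * (\<Sum>i<N. of_int (q i) * coeff Q i)"
    by (simp add: Q mult_pCons_left coeff_pCons sum_subtractf sum_distrib_left algebra_simps)
  also have "(\<Sum>i<N. of_int (q i) * (case i of 0 \<Rightarrow> 0 | Suc j \<Rightarrow> coeff Q j))
      = (\<Sum>j<N'. of_int (q (Suc j)) * coeff Q j)"
    unfolding N' by (subst sum.lessThan_Suc_shift) simp
  also have "\<dots> = (\<Sum>j<N. of_int (q (Suc j)) * coeff Q j)"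
    using QN[of N'] by (simp add: N')
  finally have eq: "(\<Sum>i<N. of_int (q i) * coeff F i)
      = (\<Sum>i<N. of_int (q (Suc i) - q i) * coeff Q i)
        + (1 - \<zeta> ^ k) * (\<Sum>i<N. of_int (q i) * coeff Q i)"
    by (simp add: sum_subtractf algebra_simps)
  have "(\<Sum>i<N. of_int (q (Suc i) - q i) * coeff Q i) \<in> pi_M"
  proof (rule insert.IH)
    show "inj_on (\<lambda>z. \<zeta> ^ z) Z" using insert.prems(1) by (simp add: inj_on_def)
    show "poly Q (\<zeta> ^ z) = 0" if "z \<in> Z" for z
    proof -
      have "\<zeta> ^ z \<noteq> \<zeta> ^ k" using insert.prems(1) insert.hyps that by (auto simp: inj_on_def)
      moreover have "poly F (\<zeta> ^ z) = 0" using insert.prems(3) that by simp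
      ultimately show ?thesis unfolding Q by simp
    qed
    show "diff_vanishes (card Z) (\<lambda>i. q (Suc i) - q i)"
      using insert.prems(4) insert.hyps by simp
  qed (use QM degQ in auto)
  moreover have "(1 - \<zeta> ^ k) * (\<Sum>i<N. of_int (q i) * coeff Q i) \<in> pi_M"
    by (intro one_minus_root_power sum_closed scale QM)
  ultimately show ?case unfolding eq by (rule pi_M_add)
qed

end

text \<open>
  Chebotarev's theorem: every square submatrix of the Fourier matrix of prime order \<open>p\<close> is
  nonsingular. For \<open>g\<close> in the kernel, let \<open>M\<close> be the \<open>\<int>[\<zeta>]\<close>-module generated by the values of
  \<open>g\<close>. Pairing the polynomial \<open>\<Sum>a. g a X ^ a\<close> with \<open>\<Prod>c\<noteq>b. (i - c)\<close> isolates \<open>g b\<close> up to an integer prime to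
  \<open>p\<close>, and so \<open>M = \<pi> M\<close>. Since \<open>p\<close> divides \<open>\<pi> ^ p\<close> this gives \<open>M = p M\<close>, whence \<open>M = 0\<close>.
\<close>
lemma minor_nonsingular:
  fixes p :: nat and g :: "nat \<Rightarrow> complex"
  assumes p: "prime p" "p > 2" and z: "\<zeta> ^ p = 1" "(\<Sum>j<p. \<zeta> ^ j) = 0" "inj_on (\<lambda>z. \<zeta> ^ z) {..<p}"
    and A: "A \<subseteq> {..<p}" and Z: "Z \<subseteq> {..<p}" and card: "card A = card Z"
    and vanish: "\<And>z. z \<in> Z \<Longrightarrow> (\<Sum>a\<in>A. g a * \<zeta> ^ (z * a)) = 0"
    and a: "a \<in> A"
  shows "g a = 0"
proof -
  define e where "e = (\<lambda>(a::nat, j::nat). g a * \<zeta> ^ j)"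
  define I where "I = A \<times> {..<p}"
  have finA: "finite A" using A finite_subset by blast
  then have finI: "finite I" by (simp add: I_def)
  have p0: "p > 0" using p by simp
  have zmod: "\<zeta> ^ (j mod p) = \<zeta> ^ j" for j
    by (metis div_mult_mod_eq mult.commute mult_1 power_add power_mult power_one z(1))
  interpret root_module "int_span e I" \<zeta>
  proof
    fix x assume "x \<in> int_span e I"
    then obtain c where x: "x = (\<Sum>i\<in>I. of_int (c i) * e i)" unfolding int_span_def by blast
    have "\<zeta> * e i \<in> int_span e I" if "i \<in> I" for i
    proof -
      have "\<zeta> * e i = e (fst i, Suc (snd i) mod p)"
        by (auto simp: e_def case_prod_beta zmod algebra_simps)
      moreover have "(fst i, Suc (snd i) mod p) \<in> I" using that p0 by (auto simp: I_def)
      ultimately show ?thesis using int_span_base[OF finI] by metis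
    qed
    then have "(\<Sum>i\<in>I. of_int (c i) * (\<zeta> * e i)) \<in> int_span e I"
      by (intro int_span_sum int_span_scale)
    then show "\<zeta> * x \<in> int_span e I" unfolding x by (simp add: sum_distrib_left mult.left_commute)
  qed (auto intro: int_span_0 int_span_add int_span_scale)
  let ?M = "int_span e I"
  have gM: "g b \<in> ?M" if "b \<in> A" for b
    using int_span_base[OF finI, of "(b, 0)" e] that p0 by (simp add: I_def e_def)
  have pi_p: "of_nat p * x \<in> pi_M" if "x \<in> ?M" for x
  proof -
    \<comment> \<open>since the powers of \<open>\<zeta>\<close> add up to zero\<close>
    have "of_nat p * x = (\<Sum>j<p. (1 - \<zeta> ^ j) * x)"
      using z(2) by (simp add: sum_subtractf flip: sum_distrib_right)
    also have "\<dots> \<in> pi_M"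
      using that by (intro pi_M_sum one_minus_root_power)
    finally show ?thesis .
  qed
  have g_pi: "g b \<in> pi_M" if b: "b \<in> A" for b
  proof -
    define q where "q = (\<lambda>i. \<Prod>c\<in>A - {b}. int i - int c)"
    define F where "F = (\<Sum>a\<in>A. monom (g a) a)"
    have cF: "coeff F i = (if i \<in> A then g i else 0)" for i
      using finA by (simp add: F_def coeff_sum)
    have "diff_vanishes (Suc (card (A - {b}))) q" unfolding q_def
      using finA by (intro diff_vanishes_prod) auto
    moreover have "Suc (card (A - {b})) = card Z" using card_Suc_Diff1[OF finA b] card by simp
    ultimately have dq: "diff_vanishes (card Z) q" by simp
    have "(\<Sum>i<p. of_int (q i) * coeff F i) \<in> pi_M"
    proof (rule difference_functional[of Z])
      show "finite Z" using Z finite_subset by blast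
      show "inj_on (\<lambda>z. \<zeta> ^ z) Z" using z(3) Z inj_on_subset by blast
      show "coeff F i \<in> ?M" for i using gM zero by (simp add: cF)
      show "poly F (\<zeta> ^ k) = 0" if "k \<in> Z" for k
        using vanish[OF that] by (simp add: F_def poly_sum poly_monom power_mult)
      have "degree F \<le> p - 1" using A p0 by (intro degree_le) (auto simp: cF)
      then show "degree F < p" using p0 by simp
    qed (use dq in simp)
    also have "(\<Sum>i<p. of_int (q i) * coeff F i) = (\<Sum>i<p. if i = b then of_int (q b) * g b else 0)"
    proof (intro sum.cong refl)
      fix i
      have "q i = 0" if "i \<in> A" "i \<noteq> b" using that finA unfolding q_def by (intro prod_zero) auto
      then show "of_int (q i) * coeff F i = (if i = b then of_int (q b) * g b else 0)"
        using b by (auto simp: cF)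
    qed
    also have "\<dots> = of_int (q b) * g b" using b A by auto
    finally have qg: "of_int (q b) * g b \<in> pi_M" .
    have "coprime (q b) (int p)"
      unfolding q_def
    proof (rule prod_coprime_left)
      fix c assume c: "c \<in> A - {b}"
      then have "b < p" "c < p" "b \<noteq> c" using A b by auto
      then have "\<not> int p dvd int b - int c"
        using dvd_imp_le_int[of "int b - int c" "int p"] by auto
      then show "coprime (int b - int c) (int p)"
        using p(1) by (metis coprime_commute prime_imp_coprime prime_nat_int_transfer)
    qed
    then obtain u v where "u * q b + v * int p = 1"
      using bezout_int[of "q b" "int p"] by (auto simp: coprime_iff_gcd_eq_1)
    then have uv: "of_int u * of_int (q b) + of_int v * of_nat p = (1::complex)"
      by (metis of_int_1 of_int_add of_int_mult of_int_of_nat_eq)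
    have "of_int u * (of_int (q b) * g b) + of_int v * (of_nat p * g b) \<in> pi_M"
      by (rule pi_M_add[OF pi_M_scale[OF qg] pi_M_scale[OF pi_p[OF gM[OF b]]]])
    also have "of_int u * (of_int (q b) * g b) + of_int v * (of_nat p * g b) = g b"
      using uv by (metis distrib_right mult.assoc mult_1)
    finally show ?thesis .
  qed
  have M_pi: "x \<in> pi_M" if x: "x \<in> ?M" for x
  proof -
    obtain c where c: "x = (\<Sum>i\<in>I. of_int (c i) * e i)" using x unfolding int_span_def by blast
    have root_pi_M: "\<zeta> ^ j * y \<in> pi_M" if "y \<in> pi_M" for j y
      using that root_power unfolding pi_M_def by (auto simp: mult.left_commute[of _ "1 - \<zeta>"])
    have "e i \<in> pi_M" if "i \<in> I" for i
      using that g_pi root_pi_M by (auto simp: I_def e_def mult.commute)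
    then have "of_int (c i) * e i \<in> pi_M" if "i \<in> I" for i using that pi_M_scale by blast
    then show ?thesis unfolding c by (rule pi_M_sum)
  qed
  have M_pow: "\<exists>y\<in>?M. x = (1 - \<zeta>) ^ k * y" if "x \<in> ?M" for x k
  proof (induction k)
    case (Suc k)
    then obtain y where y: "y \<in> ?M" "x = (1 - \<zeta>) ^ k * y" by blast
    obtain y' where "y' \<in> ?M" "y = (1 - \<zeta>) * y'" using M_pi[OF y(1)] unfolding pi_M_def by blast
    then show ?case using y by (auto simp: mult.assoc)
  qed (use that in auto)
  have pow_p: "\<exists>m\<in>?M. (1 - \<zeta>) ^ p * y = of_nat p * m" if y: "y \<in> ?M" for y
  proof -
    \<comment> \<open>in the binomial expansion of \<open>(1 - \<zeta>) ^ p\<close> the outer terms are \<open>1\<close> and \<open>- 1\<close>, and \<open>p\<close> divides the others\<close>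
    have odd: "odd p" using p prime_odd_nat by blast
    define d where "d = (\<lambda>k. (p choose k) div p)"
    have d: "p choose k = p * d k" if "k \<in> {1..<p}" for k
      using that p(1) dvd_choose_prime[of k p] by (auto simp: d_def)
    have "(1 - \<zeta>) ^ p = (\<Sum>k\<le>p. of_nat (p choose k) * (- \<zeta>) ^ k)"
      using binomial_ring[of "- \<zeta>" 1 p] by simp
    also have "{..p} = insert 0 (insert p {1..<p})" using p0 by auto
    also have "(\<Sum>k\<in>insert 0 (insert p {1..<p}). of_nat (p choose k) * (- \<zeta>) ^ k)
        = (\<Sum>k\<in>{1..<p}. of_nat (p choose k) * (- \<zeta>) ^ k)"
      using p0 odd z(1) by (simp add: power_minus_odd)
    also have "\<dots> = (\<Sum>k\<in>{1..<p}. of_nat p * (of_nat (d k) * (- \<zeta>) ^ k))"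
      by (intro sum.cong) (auto simp: d)
    also have "\<dots> * y = of_nat p * (\<Sum>k\<in>{1..<p}. of_int (int (d k) * (- 1) ^ k) * (\<zeta> ^ k * y))"
      by (simp add: sum_distrib_left sum_distrib_right power_minus[of \<zeta>] algebra_simps)
    finally have "(1 - \<zeta>) ^ p * y
      = of_nat p * (\<Sum>k\<in>{1..<p}. of_int (int (d k) * (- 1) ^ k) * (\<zeta> ^ k * y))" .
    moreover have "(\<Sum>k\<in>{1..<p}. of_int (int (d k) * (- 1) ^ k) * (\<zeta> ^ k * y)) \<in> ?M"
      by (intro sum_closed scale root_power y)
    ultimately show ?thesis by blast
  qed
  have "\<forall>i\<in>I. e i = 0"
  proof (rule nakayama_int[of "int p" I "\<lambda>_. 1"])
    fix i assume "i \<in> I"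
    then have "e i \<in> ?M" by (rule int_span_base[OF finI])
    then obtain y where y: "y \<in> ?M" "e i = (1 - \<zeta>) ^ p * y" using M_pow by blast
    obtain m where "m \<in> ?M" "(1 - \<zeta>) ^ p * y = of_nat p * m" using pow_p[OF y(1)] by blast
    then show "\<exists>m\<in>?M. of_int 1 * e i = of_int (int p) * m" using y by auto
  qed (use p finI in auto)
  moreover have "(a, 0) \<in> I" using a p0 by (simp add: I_def)
  ultimately have "e (a, 0) = 0" by blast
  then show ?thesis by (simp add: e_def)
qed

section \<open>The affine plane of order \<open>p\<close>\<close>

text \<open>
  The standard symmetric bilinear form on the plane. The lines in the direction orthogonal to \<open>v\<close> are the level
  sets of \<open>dot v\<close>.
\<close>
definition dot :: "'a::field \<times> 'a \<Rightarrow> 'a \<times> 'a \<Rightarrow> 'a" where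
  "dot v x = fst v * fst x + snd v * snd x"

text \<open>
  The quarter turn: \<open>rot v\<close> spans the line orthogonal to \<open>v\<close>, for \<open>v \<noteq> 0\<close>.
\<close>
definition rot :: "'a::field \<times> 'a \<Rightarrow> 'a \<times> 'a" where
  "rot v = (- snd v, fst v)"

lemma dot_add: "dot v (x + y) = dot v x + dot v y"
  and dot_diff: "dot v (x - y) = dot v x - dot v y"
  and dot_add_left: "dot (v + w) x = dot v x + dot w x"
  and dot_uminus: "dot (- v) x = - dot v x"
  and dot_zero: "dot v 0 = 0" "dot 0 x = 0"
  and dot_commute: "dot v x = dot x v"
  by (auto simp: dot_def algebra_simps)

lemma rot_eq_0: "rot v = 0 \<longleftrightarrow> v = 0"
  and dot_rot: "dot (rot v) v = 0"
  and rot_rot: "rot (rot v) = - v"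
  by (auto simp: rot_def dot_def prod_eq_iff algebra_simps)

section \<open>Blocking sets\<close>

lemma sum_power_field_eq_0:
  fixes k :: nat
  assumes "k < CARD('p) - 1"
  shows "(\<Sum>x\<in>UNIV. (x :: 'p::prime_card mod_ring) ^ k) = 0"
proof (cases "k = 0")
  case True
  then show ?thesis by simp
next
  case False
  have "\<exists>c :: 'p mod_ring. c \<noteq> 0 \<and> c ^ k \<noteq> 1"
  proof (rule ccontr)
    assume *: "\<not> ?thesis"
    define P :: "'p mod_ring poly" where "P = monom 1 k - 1"
    have "coeff P k = 1" using False by (simp add: P_def)
    then have P0: "P \<noteq> 0" by auto
    have "degree P \<le> k" unfolding P_def by (intro degree_diff_le) (auto simp: degree_monom_le)
    have "UNIV - {0} \<subseteq> {x. poly P x = 0}" using * by (auto simp: P_def poly_monom)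
    then have "card (UNIV - {0 :: 'p mod_ring}) \<le> card {x. poly P x = 0}"
      using P0 by (intro card_mono poly_roots_finite)
    also have "\<dots> \<le> degree P" by (rule card_poly_roots_bound[OF P0])
    finally show False using assms \<open>degree P \<le> k\<close> by (simp add: card_Diff_singleton)
  qed
  then obtain c :: "'p mod_ring" where c: "c \<noteq> 0" "c ^ k \<noteq> 1" by blast
  have "bij ((*) c)"
    using c by (intro o_bij[of "\<lambda>x. x / c"]) (auto simp: fun_eq_iff)
  then have "(\<Sum>x\<in>UNIV. x ^ k) = (\<Sum>x\<in>UNIV. (c * x) ^ k)"
    by (rule sum.reindex_bij_betw[of "(*) c" UNIV UNIV "\<lambda>x. x ^ k", symmetric])
  also have "\<dots> = c ^ k * (\<Sum>x\<in>UNIV. x ^ k)" by (simp add: power_mult_distrib sum_distrib_left)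
  finally show ?thesis using c by simp
qed

text \<open>
  A polynomial in two variables of degree less than \<open>2 (p - 1)\<close> sums to zero over the plane, stated
  for a monomial times a product of affine linear forms, so that no multivariate polynomials are needed.
\<close>
lemma sum_low_degree_eq_0:
  fixes B :: "('p::prime_card mod_ring \<times> 'p mod_ring) set"
  assumes "finite B" "i + j + card B < 2 * (CARD('p) - 1)"
  shows "(\<Sum>v\<in>UNIV. fst v ^ i * snd v ^ j * (\<Prod>x\<in>B. 1 - dot v x)) = 0"
  using assms
proof (induction B arbitrary: i j rule: finite_induct)
  case empty
  have "(\<Sum>v\<in>UNIV. fst v ^ i * snd v ^ j) = (\<Sum>a\<in>UNIV. \<Sum>b\<in>UNIV. (a :: 'p mod_ring) ^ i * b ^ j)"
    by (simp add: sum.cartesian_product case_prod_beta)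
  also have "\<dots> = (\<Sum>a\<in>UNIV. a ^ i) * (\<Sum>b\<in>UNIV. b ^ j)"
    by (simp add: sum_product)
  also have "\<dots> = 0"
  proof (cases "i < CARD('p) - 1")
    case False
    then have "j < CARD('p) - 1" using empty by simp
    then show ?thesis by (simp add: sum_power_field_eq_0)
  qed (simp add: sum_power_field_eq_0)
  finally show ?case by simp
next
  case (insert x B)
  let ?P = "\<lambda>v. \<Prod>x\<in>B. 1 - dot v x"
  have "(\<Sum>v\<in>UNIV. fst v ^ i * snd v ^ j * (\<Prod>x\<in>insert x B. 1 - dot v x))
     = (\<Sum>v\<in>UNIV. fst v ^ i * snd v ^ j * ?P v)
       - fst x * (\<Sum>v\<in>UNIV. fst v ^ Suc i * snd v ^ j * ?P v)
       - snd x * (\<Sum>v\<in>UNIV. fst v ^ i * snd v ^ Suc j * ?P v)"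
    unfolding sum_distrib_left sum_subtractf[symmetric] using insert.hyps
    by (intro sum.cong refl) (simp add: dot_def algebra_simps)
  also have "(\<Sum>v\<in>UNIV. fst v ^ i * snd v ^ j * ?P v) = 0"
    using insert by (intro insert.IH) auto
  also have "(\<Sum>v\<in>UNIV. fst v ^ Suc i * snd v ^ j * ?P v) = 0"
    using insert by (intro insert.IH) auto
  also have "(\<Sum>v\<in>UNIV. fst v ^ i * snd v ^ Suc j * ?P v) = 0"
    using insert by (intro insert.IH) auto
  finally show ?case by simp
qed

text \<open>
  The theorem of Jamison and of Brouwer and Schrijver for the plane of order \<open>p\<close>: a set that meets every line has at
  least \<open>2 p - 1\<close> points. After a translation that moves a point of the set to the origin, the product
  of \<open>1 - dot v x\<close> over the other points \<open>x\<close> is the indicator function of \<open>v = 0\<close>, which does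
  not sum to zero.
\<close>
theorem blocking_set_card:
  fixes B :: "('p::prime_card mod_ring \<times> 'p mod_ring) set"
  assumes "\<And>v c. v \<noteq> 0 \<Longrightarrow> \<exists>x\<in>B. dot v x = c"
  shows "card B \<ge> 2 * CARD('p) - 1"
proof (rule ccontr)
  assume less: "\<not> ?thesis"
  obtain b where b: "b \<in> B" using assms[of "(1, 0)" 0] by (auto simp: zero_prod_def)
  define C where "C = (\<lambda>x. x - b) ` (B - {b})"
  have "card C \<le> card (B - {b})" unfolding C_def by (intro card_image_le) simp
  also have "\<dots> < card B" using b by (intro psubset_card_mono) auto
  finally have "0 + 0 + card C < 2 * (CARD('p) - 1)" using less by simp
  then have "(\<Sum>v\<in>UNIV. fst v ^ 0 * snd v ^ 0 * (\<Prod>x\<in>C. 1 - dot v x)) = 0"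
    by (intro sum_low_degree_eq_0) auto
  moreover have "(\<Prod>x\<in>C. 1 - dot v x) = (if v = 0 then 1 else 0)" for v
  proof (cases "v = 0")
    case False
    then obtain x where x: "x \<in> B" "dot v x = 1 + dot v b" using assms by blast
    then have "x \<noteq> b" "dot v (x - b) = 1" by (auto simp: dot_diff)
    then have "x - b \<in> C" using x by (auto simp: C_def)
    then show ?thesis using False \<open>dot v (x - b) = 1\<close> by (auto intro!: prod_zero)
  qed (simp add: dot_zero)
  ultimately show False by simp
qed

lemma lines_meet:
  assumes "snd v * fst w \<noteq> fst v * snd w"
  shows "\<exists>x. dot v x = c \<and> dot w x = d"
proof -
  define e where "e = fst v * snd w - snd v * fst w"
  have "e \<noteq> 0" using assms by (auto simp: e_def)
  define x where "x = ((c * snd w - d * snd v) / e, (d * fst v - c * fst w) / e)"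
  have "dot v x = (fst v * (c * snd w - d * snd v) + snd v * (d * fst v - c * fst w)) / e"
    by (simp add: dot_def x_def add_divide_distrib)
  also have "\<dots> = c * e / e" unfolding e_def by (simp add: algebra_simps)
  finally have v: "dot v x = c" using \<open>e \<noteq> 0\<close> by simp
  have "dot w x = (fst w * (c * snd w - d * snd v) + snd w * (d * fst v - c * fst w)) / e"
    by (simp add: dot_def x_def add_divide_distrib)
  also have "\<dots> = d * e / e" unfolding e_def by (simp add: algebra_simps)
  finally have w: "dot w x = d" using \<open>e \<noteq> 0\<close> by simp
  show ?thesis using v w by blast
qed

text \<open>
  Pairwise nonparallel lines can be hit two at a time, by their points of intersection.
\<close>
lemma cover_lines_by_points:
  assumes "finite D" "\<And>v. v \<in> D \<Longrightarrow> v \<noteq> 0"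
    and "\<And>v w. v \<in> D \<Longrightarrow> w \<in> D \<Longrightarrow> v \<noteq> w \<Longrightarrow> snd v * fst w \<noteq> fst v * snd w"
  shows "\<exists>T. finite T \<and> 2 * card T \<le> card D + 1 \<and> (\<forall>v\<in>D. \<exists>x\<in>T. dot v x = m v)"
  using assms
proof (induction "card D" arbitrary: D rule: less_induct)
  case less
  consider "D = {}" | v where "D = {v}" | v w where "v \<in> D" "w \<in> D" "v \<noteq> w"
  proof (cases "\<exists>v\<in>D. \<exists>w\<in>D. v \<noteq> w")
    case False
    then have "D = {} \<or> (\<exists>v. D = {v})" by fast
    then show ?thesis using that(1,2) by metis
  qed (use that(3) in metis)
  then show ?case
  proof cases
    case 1
    then show ?thesis by (intro exI[of _ "{}"]) auto
  next
    case (2 v)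
    then have "v \<noteq> 0" using less.prems by auto
    have "\<exists>x. dot v x = m v"
    proof (cases "fst v = 0")
      case True
      then have "snd v \<noteq> 0" using \<open>v \<noteq> 0\<close> by (auto simp: prod_eq_iff)
      then show ?thesis by (intro exI[of _ "(0, m v / snd v)"]) (simp add: dot_def)
    next
      case False
      then show ?thesis by (intro exI[of _ "(m v / fst v, 0)"]) (simp add: dot_def)
    qed
    then obtain x where "dot v x = m v" by blast
    then show ?thesis using 2 by (intro exI[of _ "{x}"]) auto
  next
    case (3 v w)
    obtain x where x: "dot v x = m v" "dot w x = m w"
      using lines_meet[of v w "m v" "m w"] less.prems(3) 3 by auto
    have c: "card (D - {v, w}) + 2 = card D"
      using 3 less.prems(1) card_mono[of D "{v, w}"] by (simp add: card_Diff_subset)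
    then have "\<exists>T. finite T \<and> 2 * card T \<le> card (D - {v, w}) + 1 \<and> (\<forall>v\<in>D - {v, w}. \<exists>x\<in>T. dot v x = m v)"
      using less.prems by (intro less.hyps) auto
    then obtain T where "finite T" "2 * card T \<le> card (D - {v, w}) + 1"
      "\<forall>v\<in>D - {v, w}. \<exists>x\<in>T. dot v x = m v" by blast
    moreover from this have "card (insert x T) \<le> card T + 1" by (simp add: card_insert_if)
    ultimately show ?thesis using c x by (intro exI[of _ "insert x T"]) auto
  qed
qed

text \<open>
  If a set misses at most one line of each of the \<open>p + 1\<close> parallel classes, then \<open>(p + 1) / 2\<close> additional
  points suffice to turn it into a blocking set.
\<close>
lemma almost_blocking_set_card:
  fixes S :: "('p::prime_card mod_ring \<times> 'p mod_ring) set"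
  assumes "odd CARD('p)" and "\<And>v. v \<noteq> 0 \<Longrightarrow> card (dot v ` S) \<ge> CARD('p) - 1"
  shows "2 * card S \<ge> 3 * CARD('p) - 3"
proof -
  \<comment> \<open>one normal vector for each parallel class of lines\<close>
  define D :: "('p mod_ring \<times> 'p mod_ring) set" where "D = insert (0, 1) (range (\<lambda>t. (1, t)))"
  have "\<exists>m. UNIV - {m} \<subseteq> dot v ` S" if "v \<noteq> 0" for v
  proof -
    have "card (- dot v ` S) \<le> 1" using assms(2)[OF that] by (simp add: Compl_eq_Diff_UNIV card_Diff_subset)
    then have eq: "a = b" if "a \<in> - dot v ` S" "b \<in> - dot v ` S" for a b
      using card_le_Suc0_iff_eq[of "- dot v ` S"] that by simp
    show ?thesis
    proof (cases "- dot v ` S = {}")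
      case True
      then show ?thesis by (intro exI[of _ 0]) blast
    next
      case False
      then obtain m where "m \<in> - dot v ` S" by blast
      then have "UNIV - {m} \<subseteq> dot v ` S" using eq[of m] by blast
      then show ?thesis by blast
    qed
  qed
  then obtain m where m: "\<And>v. v \<noteq> 0 \<Longrightarrow> UNIV - {m v} \<subseteq> dot v ` S" by metis
  have "card (range (\<lambda>t :: 'p mod_ring. (1 :: 'p mod_ring, t))) = CARD('p)"
    by (subst card_image) (auto simp: inj_on_def)
  then have cD: "card D \<le> CARD('p) + 1" unfolding D_def by (subst card_insert_if) auto
  have "\<exists>T. finite T \<and> 2 * card T \<le> card D + 1 \<and> (\<forall>v\<in>D. \<exists>x\<in>T. dot v x = m v)"
    by (rule cover_lines_by_points) (auto simp: D_def zero_prod_def)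
  then obtain T where T: "2 * card T \<le> card D + 1" "\<And>v. v \<in> D \<Longrightarrow> \<exists>x\<in>T. dot v x = m v" by blast
  have T': "2 * card T \<le> CARD('p) + 1"
  proof -
    have "2 * card T \<le> CARD('p) + 2" using T cD by simp
    \<comment> \<open>parity improves the bound by one\<close>
    moreover have "2 * card T \<noteq> CARD('p) + 2" using assms(1) by presburger
    ultimately show ?thesis by simp
  qed
  have D: "\<exists>x\<in>S \<union> T. dot v x = c" if "v \<in> D" for v c
  proof -
    have "v \<noteq> 0" using that by (auto simp: D_def zero_prod_def)
    then show ?thesis using m[of v] T(2)[OF that] by (cases "c = m v") blast+
  qed
  have "card (S \<union> T) \<ge> 2 * CARD('p) - 1"
  proof (rule blocking_set_card)
    fix v :: "'p mod_ring \<times> 'p mod_ring" and c assume "v \<noteq> 0"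
    show "\<exists>x\<in>S \<union> T. dot v x = c"
    proof (cases "fst v = 0")
      case True
      then have "snd v \<noteq> 0" using \<open>v \<noteq> 0\<close> by (auto simp: prod_eq_iff)
      moreover obtain x where "x \<in> S \<union> T" "dot (0, 1) x = c / snd v"
        using D[of "(0, 1)" "c / snd v"] by (auto simp: D_def)
      ultimately show ?thesis using True by (intro bexI[of _ x]) (auto simp: dot_def)
    next
      case False
      obtain x where "x \<in> S \<union> T" "dot (1, snd v / fst v) x = c / fst v"
        using D[of "(1, snd v / fst v)" "c / fst v"] by (auto simp: D_def)
      moreover have "dot v x = fst v * dot (1, snd v / fst v) x"
        using False by (simp add: dot_def distrib_left)
      ultimately show ?thesis using False by (intro bexI[of _ x]) auto
    qed
  qed
  moreover have "card (S \<union> T) \<le> card S + card T" by (rule card_Un_le)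
  ultimately show ?thesis using T' by linarith
qed

section \<open>Counting along parallel lines\<close>

lemma card_ge_image_times_fibre:
  assumes "finite S" "\<And>x. x \<in> S \<Longrightarrow> card {y \<in> S. h y = h x} \<ge> t"
  shows "card (h ` S) * t \<le> card S"
proof -
  have "card S = (\<Sum>c\<in>h ` S. card {y \<in> S. h y = c})"
    using sum.image_gen[OF assms(1), of "\<lambda>_. 1::nat" h] by simp
  moreover have "(\<Sum>c\<in>h ` S. t) \<le> (\<Sum>c\<in>h ` S. card {y \<in> S. h y = c})"
    using assms(2) by (intro sum_mono) auto
  ultimately show ?thesis by simp
qed

text \<open>
  The concave function \<open>n (p + 1 - n)\<close> takes at \<open>1\<close>, \<open>2\<close> and \<open>3\<close> the same values as at \<open>p\<close>, \<open>p - 1\<close>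
  and \<open>p - 2\<close>, and is not smaller in between.
\<close>
lemma mult_reflect_ge_2:
  fixes n p :: nat
  assumes "2 \<le> n" "n \<le> p - 1" "p > 3"
  shows "n * (p + 1 - n) \<ge> 2 * (p - 1)"
proof -
  obtain a where a: "n = 2 + a" using assms le_Suc_ex by blast
  obtain b where b: "p = n + 1 + b" using that[of "p - (n + 1)"] assms by simp
  show ?thesis unfolding a b by (simp add: algebra_simps)
qed

lemma mult_reflect_ge_3:
  fixes n p :: nat
  assumes "3 \<le> n" "n \<le> p - 2" "p > 3"
  shows "n * (p + 1 - n) \<ge> 3 * (p - 2)"
proof -
  obtain a where a: "n = 3 + a" using assms le_Suc_ex by blast
  obtain b where b: "p = n + 2 + b" using that[of "p - (n + 2)"] assms by simp
  show ?thesis unfolding a b by (simp add: algebra_simps)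
qed

lemma mult_reflect_ge_1:
  fixes n p :: nat
  assumes "1 \<le> n" "n \<le> p"
  shows "n * (p + 1 - n) \<ge> p"
proof -
  obtain a where a: "n = 1 + a" using assms le_Suc_ex by blast
  obtain b where b: "p = n + b" using assms le_Suc_ex[of "n" p] by auto
  show ?thesis unfolding a b by (simp add: algebra_simps)
qed

lemma line_card:
  fixes v :: "'p::prime_card mod_ring \<times> 'p mod_ring"
  assumes "v \<noteq> 0"
  shows "card {x. dot v x = c} = CARD('p)"
proof (cases "snd v = 0")
  case True
  then have "fst v \<noteq> 0" using assms by (auto simp: prod_eq_iff)
  then have "{x. dot v x = c} = range (\<lambda>t. (c / fst v, t))"
    using True by (auto simp: dot_def field_simps image_iff)
  then show ?thesis by (simp add: card_image inj_on_def)
next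
  case False
  have "{x. dot v x = c} = range (\<lambda>t. (t, (c - fst v * t) / snd v))"
    using False by (auto simp: dot_def field_simps image_iff)
  then show ?thesis by (simp add: card_image inj_on_def)
qed

section \<open>The combinatorial core\<close>

text \<open>
  The combinatorial properties of the support \<open>S\<close> of a function and the support \<open>X\<close> of its Fourier transform
  that the argument uses, both as subsets of the plane. The fibre conditions say that the numbers of points of one set on a
  line that meets it and of lines in the dual direction that meet the other set add up to at least \<open>p + 1\<close>.
  Moreover \<open>S\<close> is the smaller set, it has at least three points, and the product bound is violated.
\<close>
locale uncertain_pair =
  fixes S X :: "('p::prime_card mod_ring \<times> 'p mod_ring) set" and p :: nat
  assumes p: "p = CARD('p)" "p > 3"
    and fibre_X: "\<And>v a. v \<noteq> 0 \<Longrightarrow> a \<in> X \<Longrightarrow>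
      card {b \<in> X. dot (rot v) b = dot (rot v) a} + card (dot v ` S) \<ge> p + 1"
    and fibre_S: "\<And>v x. v \<noteq> 0 \<Longrightarrow> x \<in> S \<Longrightarrow>
      card {y \<in> S. dot v y = dot v x} + card (dot (rot v) ` X) \<ge> p + 1"
    and card_S: "3 \<le> card S" "card S \<le> card X"
    and small: "card S * card X < 3 * p * (p - 2)"
begin

lemma odd_p: "odd p"
  using p prime_card[where ?'a = 'p] prime_odd_nat by auto

lemma card_image_bounds:
  assumes "T \<noteq> {}" shows "1 \<le> card (dot v ` T)" "card (dot v ` (T :: ('p mod_ring \<times> 'p mod_ring) set)) \<le> p"
proof -
  show "1 \<le> card (dot v ` T)" using assms by (simp add: Suc_le_eq card_gt_0_iff)
  show "card (dot v ` T) \<le> p"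
    using card_mono[of UNIV "dot v ` T"] p by simp
qed

lemma nonempty: "S \<noteq> {}" "X \<noteq> {}"
  using card_S by auto

lemma S_bound: "v \<noteq> 0 \<Longrightarrow> card (dot v ` S) * (p + 1 - card (dot (rot v) ` X)) \<le> card S"
  using fibre_S[of v] by (intro card_ge_image_times_fibre) (auto simp: le_diff_conv)

lemma X_bound: "v \<noteq> 0 \<Longrightarrow> card (dot (rot v) ` X) * (p + 1 - card (dot v ` S)) \<le> card X"
  using fibre_X[of v] by (intro card_ge_image_times_fibre) (auto simp: le_diff_conv)

text \<open>
  If \<open>S\<close> meets \<open>n\<close> lines of a parallel class and \<open>X\<close> meets \<open>m\<close> lines of the dual one, then
  \<open>n (p + 1 - n) m (p + 1 - m)\<close> is at most \<open>|S| |X|\<close>. As the latter is small, \<open>n\<close> and \<open>m\<close> can only be very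
  close to \<open>1\<close> or to \<open>p\<close>.
\<close>
lemma product_bound:
  assumes "v \<noteq> 0" "n = card (dot v ` S)" "m = card (dot (rot v) ` X)"
  shows "(n * (p + 1 - n)) * (m * (p + 1 - m)) < 3 * p * (p - 2)"
proof -
  have "(n * (p + 1 - n)) * (m * (p + 1 - m)) = (n * (p + 1 - m)) * (m * (p + 1 - n))"
    by (simp add: mult_ac)
  also have "\<dots> \<le> card S * card X"
    using S_bound[OF assms(1)] X_bound[OF assms(1)] assms(2,3) by (intro mult_le_mono) auto
  finally show ?thesis using small by simp
qed

lemma not_collinear_imp_many_lines:
  assumes v: "v \<noteq> 0" and n: "card (dot v ` S) \<noteq> 1"
  shows "card (dot v ` S) \<ge> p - 1"
proof (rule ccontr)
  define n m where "n = card (dot v ` S)" and "m = card (dot (rot v) ` X)"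
  assume "\<not> card (dot v ` S) \<ge> p - 1"
  then have "2 \<le> n" "n \<le> p - 2" using n card_image_bounds[OF nonempty(1), of v] by (auto simp: n_def)
  have m: "1 \<le> m" "m \<le> p" using card_image_bounds[OF nonempty(2)] by (auto simp: m_def)
  have prod: "(n * (p + 1 - n)) * (m * (p + 1 - m)) < 3 * p * (p - 2)"
    using product_bound[OF v n_def m_def] .
  have "n = 2"
  proof (rule ccontr)
    assume "n \<noteq> 2"
    then have "3 * (p - 2) \<le> n * (p + 1 - n)"
      using \<open>2 \<le> n\<close> \<open>n \<le> p - 2\<close> p by (intro mult_reflect_ge_3) auto
    then have "3 * (p - 2) * p \<le> (n * (p + 1 - n)) * (m * (p + 1 - m))"
      using mult_reflect_ge_1[OF m] by (rule mult_le_mono)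
    then show False using prod by (simp add: mult_ac)
  qed
  have "m = 1 \<or> m = p"
  proof (rule ccontr)
    assume "\<not> ?thesis"
    then have "2 * (p - 1) \<le> m * (p + 1 - m)"
      using m p by (intro mult_reflect_ge_2) auto
    moreover have "2 * (p - 1) \<le> n * (p + 1 - n)" using \<open>n = 2\<close> by simp
    ultimately have "(2 * (p - 1)) * (2 * (p - 1)) \<le> (n * (p + 1 - n)) * (m * (p + 1 - m))"
      using mult_le_mono by blast
    moreover obtain c where "p = c + 4" using p le_Suc_ex[of 4 p] by auto
    ultimately show False using prod by (simp add: algebra_simps)
  qed
  then show False
  proof
    assume m: "m = 1"
    then have "2 * p \<le> card S" using S_bound[OF v] \<open>n = 2\<close> by (simp add: n_def m_def)
    moreover have "card X \<le> p"
    proof -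
      obtain c where "dot (rot v) ` X = {c}" using m by (auto simp: m_def card_1_singleton_iff)
      then have "X \<subseteq> {x. dot (rot v) x = c}" by auto
      then have "card X \<le> card {x. dot (rot v) x = c}" by (intro card_mono) auto
      then show ?thesis using line_card[of "rot v" c] v p by (simp add: rot_eq_0)
    qed
    ultimately show False using card_S p by simp
  next
    assume "m = p"
    then have "p * (p - 1) \<le> card X" using X_bound[OF v] \<open>n = 2\<close> by (simp add: n_def m_def)
    then have "3 * (p * (p - 1)) \<le> card S * card X" using card_S by (intro mult_le_mono) auto
    moreover have "3 * p * (p - 2) \<le> 3 * (p * (p - 1))"
      unfolding mult.assoc by (intro mult_le_mono2 diff_le_mono2) simp
    ultimately show False using small by linarith
  qed
qed

text \<open>
  If \<open>S\<close> were not contained in a line, it would meet all lines but at most one in every direction, and so would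
  have at least \<open>3 (p - 1) / 2\<close> points. It would also have a line with just one point in every direction,
  so that \<open>X\<close> would be a blocking set. Then \<open>|S| |X| \<ge> 3 (p - 1) (2 p - 1) / 2\<close> would be too large.
\<close>
lemma collinear: "\<exists>v. v \<noteq> 0 \<and> card (dot v ` S) = 1"
proof (rule ccontr)
  assume "\<not> ?thesis"
  then have N: "card (dot v ` S) \<ge> p - 1" if "v \<noteq> 0" for v
    using that not_collinear_imp_many_lines by blast
  have S: "2 * card S \<ge> 3 * p - 3"
    using almost_blocking_set_card[of S] N odd_p p by auto
  have "card X \<ge> 2 * CARD('p) - 1"
  proof (rule blocking_set_card)
    fix w :: "'p mod_ring \<times> 'p mod_ring" and c assume w: "w \<noteq> 0"
    define v where "v = - rot w"
    have v: "v \<noteq> 0" "rot v = w" using w by (auto simp: v_def rot_def prod_eq_iff)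
    \<comment> \<open>otherwise \<open>|S| \<ge> 2 (p - 1)\<close>, and \<open>4 (p - 1)\<^sup>2\<close> exceeds the bound on \<open>|S| |X|\<close>\<close>
    have "\<exists>x\<in>S. card {y \<in> S. dot v y = dot v x} \<le> 1"
    proof (rule ccontr)
      assume "\<not> ?thesis"
      then have "card (dot v ` S) * 2 \<le> card S" by (intro card_ge_image_times_fibre) auto
      then have "(p - 1) * 2 \<le> card S" using N[OF v(1)] by simp
      then have "((p - 1) * 2) * ((p - 1) * 2) \<le> card S * card X"
        using card_S by (intro mult_le_mono) auto
      moreover obtain c where "p = c + 4" using p le_Suc_ex[of 4 p] by auto
      ultimately show False using small by (simp add: algebra_simps)
    qed
    then obtain x where "x \<in> S" "card {y \<in> S. dot v y = dot v x} \<le> 1" by blast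
    then have "card (dot w ` X) \<ge> p" using fibre_S[OF v(1), of x] v by simp
    then have "dot w ` X = UNIV" using p by (intro card_seteq) auto
    then show "\<exists>x\<in>X. dot w x = c" by (metis UNIV_I imageE)
  qed
  then have "(3 * p - 3) * (2 * p - 1) \<le> (2 * card S) * card X"
    using S p by (intro mult_le_mono) auto
  moreover obtain c where "p = c + 4" using p le_Suc_ex[of 4 p] by auto
  ultimately show False using small by (simp add: algebra_simps)
qed

text \<open>
  Once \<open>S\<close> lies on a line, \<open>X\<close> is a union of lines of the dual direction, at least \<open>p + 1 - |S|\<close> in number, and
  the bound on \<open>|S| |X|\<close> leaves at most two of them.
\<close>
theorem line_structure:
  "\<exists>v c C. v \<noteq> 0 \<and> S \<subseteq> {x. dot v x = c} \<and> card S \<ge> p - 1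
     \<and> (card C = 1 \<or> card C = 2) \<and> X = {a. dot (rot v) a \<in> C}"
proof -
  obtain v where v: "v \<noteq> 0" "card (dot v ` S) = 1" using collinear by blast
  then obtain c where c: "dot v ` S = {c}" by (auto simp: card_1_singleton_iff)
  define C where "C = dot (rot v) ` X"
  have fibres: "{b \<in> X. dot (rot v) b = dot (rot v) a} = {b. dot (rot v) b = dot (rot v) a}"
    if "a \<in> X" for a
    using fibre_X[OF v(1) that] v line_card[of "rot v"] p
    by (intro card_seteq) (auto simp: rot_eq_0)
  have X: "X = {a. dot (rot v) a \<in> C}"
  proof
    show "{a. dot (rot v) a \<in> C} \<subseteq> X" using fibres unfolding C_def by blast
  qed (auto simp: C_def)
  have Sc: "S \<subseteq> {x. dot v x = c}" using c by auto
  then have Sp: "card S \<le> p" using card_mono[of "{x. dot v x = c}" S] line_card[OF v(1), of c] p by simp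
  obtain x where x: "x \<in> S" using nonempty by blast
  have "{y \<in> S. dot v y = dot v x} = S" using Sc x by auto
  then have SC: "card S + card C \<ge> p + 1" using fibre_S[OF v(1) x] by (simp add: C_def)
  have CX: "card C * p \<le> card X" using X_bound[OF v(1)] v(2) by (simp add: C_def)
  have "card S * (card C * p) < 3 * p * (p - 2)"
    by (rule le_less_trans[OF mult_le_mono2[OF CX] small])
  then have "(card S * card C) * p < (3 * (p - 2)) * p" by (simp only: mult_ac)
  then have lt: "card S * card C < 3 * (p - 2)" using p by simp
  have "card S \<ge> p - 1"
  proof (rule ccontr)
    assume "\<not> ?thesis"
    then have "3 * (p - 2) \<le> card S * (p + 1 - card S)"
      using card_S p by (intro mult_reflect_ge_3) auto
    also have "\<dots> \<le> card S * card C" using SC by (intro mult_le_mono2) simp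
    finally show False using lt by simp
  qed
  moreover have "card C < 3"
  proof (rule ccontr)
    assume "\<not> ?thesis"
    then have "(p - 1) * 3 \<le> card S * card C" using \<open>card S \<ge> p - 1\<close> by (intro mult_le_mono) auto
    then show False using lt p by simp
  qed
  moreover have "card C \<ge> 1" using SC Sp by simp
  ultimately show ?thesis using v(1) Sc X
    by (intro exI[of _ v] exI[of _ c] exI[of _ C]) auto
qed

end

section \<open>Characters and the uncertainty principle of a prime field\<close>

definition root_of_unity :: "nat \<Rightarrow> complex" where
  "root_of_unity n = cis (2 * pi / real n)"

lemma root_of_unity_power: "root_of_unity n ^ k = cis (2 * pi * real k / real n)"
  by (simp add: root_of_unity_def DeMoivre mult_ac)

lemma root_of_unity_power_self: "n > 0 \<Longrightarrow> root_of_unity n ^ n = 1"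
  by (simp add: root_of_unity_power)

lemma inj_on_root_of_unity_power: "n > 0 \<Longrightarrow> inj_on (\<lambda>k. root_of_unity n ^ k) {..<n}"
  using bij_betw_roots_unity[of n] by (simp add: bij_betw_def root_of_unity_power)

lemma sum_root_of_unity_power:
  assumes "n > 1" shows "(\<Sum>k<n. root_of_unity n ^ k) = 0"
proof -
  have "root_of_unity n ^ 1 \<noteq> root_of_unity n ^ 0"
    using inj_onD[OF inj_on_root_of_unity_power[of n], of 1 0] assms by auto
  moreover have "(1 - root_of_unity n) * (\<Sum>k<n. root_of_unity n ^ k) = 0"
    using root_of_unity_power_self[of n] assms by (simp flip: one_diff_power_eq)
  ultimately show ?thesis by simp
qed

text \<open>
  A nontrivial additive character of the prime field; every additive character is its composition with a scaling.
\<close>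
definition add_char :: "'p::prime_card mod_ring \<Rightarrow> complex" where
  "add_char x = root_of_unity CARD('p) ^ nat (to_int_mod_ring x)"

lemma nat_to_int_mod_ring_less: "nat (to_int_mod_ring (x :: 'p::prime_card mod_ring)) < CARD('p)"
  using range_to_int_mod_ring[where ?'a = 'p] by (metis atLeastLessThan_iff nat_less_iff rangeI)

lemma of_nat_nat_to_int_mod_ring: "of_nat (nat (to_int_mod_ring x)) = (x :: 'p::prime_card mod_ring)"
proof -
  have "to_int_mod_ring x \<ge> 0" using range_to_int_mod_ring[where ?'a = 'p] by (metis atLeastLessThan_iff rangeI)
  then show ?thesis by (simp add: of_nat_of_int_mod_ring)
qed

lemma add_char_of_nat: "add_char (of_nat k :: 'p::prime_card mod_ring) = root_of_unity CARD('p) ^ k"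
proof -
  have "to_int_mod_ring (of_nat k :: 'p mod_ring) = int k mod int CARD('p)"
    by (simp add: of_nat_of_int_mod_ring to_int_mod_ring.rep_eq of_int_mod_ring.rep_eq)
  then have "nat (to_int_mod_ring (of_nat k :: 'p mod_ring)) = k mod CARD('p)"
    by (simp add: nat_mod_distrib)
  moreover have "root_of_unity CARD('p) ^ (k mod CARD('p)) = root_of_unity CARD('p) ^ k"
    by (metis div_mult_mod_eq mult.commute mult_1 power_add power_mult power_one
        root_of_unity_power_self zero_less_card_finite)
  ultimately show ?thesis by (simp add: add_char_def)
qed

lemma add_char_0: "add_char 0 = 1"
  using add_char_of_nat[of 0] by simp

lemma add_char_add: "add_char (x + y) = add_char x * add_char (y :: 'p::prime_card mod_ring)"
  by (metis add_char_of_nat of_nat_add of_nat_nat_to_int_mod_ring power_add)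

lemma add_char_nonzero: "add_char x \<noteq> 0"
  by (metis add_char_0 add_char_add add.right_inverse mult_zero_left zero_neq_one)

lemma add_char_eq_1_iff: "add_char (x :: 'p::prime_card mod_ring) = 1 \<longleftrightarrow> x = 0"
proof
  assume "add_char x = 1"
  then have "root_of_unity CARD('p) ^ nat (to_int_mod_ring x) = root_of_unity CARD('p) ^ 0"
    by (simp add: add_char_def)
  then have "nat (to_int_mod_ring x) = 0"
    using inj_onD[OF inj_on_root_of_unity_power[of "CARD('p)"]] nat_to_int_mod_ring_less[of x]
    by (metis lessThan_iff zero_less_card_finite)
  then show "x = 0" using of_nat_nat_to_int_mod_ring[of x] by simp
qed (simp add: add_char_0)

lemma cnj_add_char: "cnj (add_char x) = add_char (- x)"
proof -
  have "norm (add_char x) = 1"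
    by (simp add: add_char_def norm_power root_of_unity_def)
  then have "add_char x * cnj (add_char x) = add_char x * add_char (- x)"
    by (simp add: complex_norm_square[symmetric] add_char_0 flip: add_char_add)
  then show ?thesis using add_char_nonzero[of x] by simp
qed

lemma sum_add_char: 
  "(\<Sum>x\<in>UNIV. add_char (x * y)) = (if y = 0 then of_nat CARD('p) else 0)" for y :: "'p::prime_card mod_ring"
proof (cases "y = 0")
  case False
  have "(\<Sum>x\<in>UNIV. add_char (x * y)) = (\<Sum>x\<in>UNIV. add_char ((x + 1) * y))"
    by (rule sum.reindex_bij_witness[of _ "\<lambda>x. x + 1" "\<lambda>x. x - 1"]) auto
  also have "\<dots> = (\<Sum>x\<in>UNIV. add_char (x * y)) * add_char y"
    by (simp add: distrib_right add_char_add sum_distrib_right)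
  finally show ?thesis using False by (simp add: add_char_eq_1_iff)
qed (simp add: add_char_0)

text \<open>
  The uncertainty principle for groups of prime order (Tao, Biro, Meshulam). If it failed, the restriction
  of \<open>g\<close> to its support would be in the kernel of a square submatrix of the Fourier matrix.
\<close>
theorem uncertainty_prime_field:
  fixes g :: "'p::prime_card mod_ring \<Rightarrow> complex"
  assumes p: "CARD('p) > 2" and g: "g a \<noteq> 0"
  shows "CARD('p) + 1 \<le> card {x. g x \<noteq> 0} + card {t. (\<Sum>x\<in>UNIV. g x * add_char (t * x)) \<noteq> 0}"
proof (rule ccontr)
  assume less: "\<not> ?thesis"
  define S where "S = {x. g x \<noteq> 0}"
  define Y where "Y = {t. (\<Sum>x\<in>UNIV. g x * add_char (t * x)) = 0}"
  define r :: "'p mod_ring \<Rightarrow> nat" where "r = (\<lambda>x. nat (to_int_mod_ring x))"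
  have r: "of_nat (r x) = x" "r x < CARD('p)" for x
    by (simp_all add: r_def of_nat_nat_to_int_mod_ring nat_to_int_mod_ring_less)
  have inj: "inj r" by (metis r(1) injI)
  have "{t. (\<Sum>x\<in>UNIV. g x * add_char (t * x)) \<noteq> 0} = UNIV - Y" by (auto simp: Y_def)
  then have "card {t. (\<Sum>x\<in>UNIV. g x * add_char (t * x)) \<noteq> 0} = CARD('p) - card Y"
    by (simp add: card_Diff_subset)
  moreover have "card Y \<le> CARD('p)" using card_mono[of UNIV Y] by simp
  ultimately have "card S \<le> card Y" using less by (simp add: S_def)
  then obtain Z where Z: "Z \<subseteq> Y" "card Z = card S" by (metis obtain_subset_with_card_n)
  have "g (of_nat (r a)) = 0"
  proof (rule minor_nonsingular[of "CARD('p)" "root_of_unity CARD('p)" "r ` S" "r ` Z" "\<lambda>n. g (of_nat n)"])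
    show "card (r ` S) = card (r ` Z)"
      using Z(2) by (metis card_image inj inj_on_subset subset_UNIV)
    show "r a \<in> r ` S" using g by (simp add: S_def)
    fix z assume "z \<in> r ` Z"
    then obtain t where t: "t \<in> Z" "z = r t" by blast
    have "(\<Sum>a\<in>r ` S. g (of_nat a) * root_of_unity CARD('p) ^ (z * a))
        = (\<Sum>x\<in>S. g (of_nat (r x)) * root_of_unity CARD('p) ^ (r t * r x))"
      unfolding t by (subst sum.reindex) (use inj inj_on_subset in auto)
    also have "\<dots> = (\<Sum>x\<in>S. g x * add_char (t * x))"
      using r(1) by (metis (no_types, lifting) add_char_of_nat of_nat_mult)
    also have "\<dots> = (\<Sum>x\<in>UNIV. g x * add_char (t * x))"
      by (intro sum.mono_neutral_left) (auto simp: S_def)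
    also have "\<dots> = 0" using t Z(1) by (auto simp: Y_def)
    finally show "(\<Sum>a\<in>r ` S. g (of_nat a) * root_of_unity CARD('p) ^ (z * a)) = 0" .
  qed (use p r prime_card in \<open>auto intro: root_of_unity_power_self sum_root_of_unity_power inj_on_root_of_unity_power\<close>)
  then show False using g r by simp
qed

section \<open>The Fourier transform on the plane\<close>

text \<open>
  The Fourier transform in coordinates: the plane is identified with its dual through \<^const>\<open>dot\<close>.
  It is not normalized.
\<close>
definition plane_fourier :: "('p::prime_card mod_ring \<times> 'p mod_ring \<Rightarrow> complex) \<Rightarrow> 'p mod_ring \<times> 'p mod_ring \<Rightarrow> complex" where
  "plane_fourier f a = (\<Sum>x\<in>UNIV. f x * add_char (- dot a x))"

text \<open>
  On the line \<open>a - t v\<close> the transform of \<open>f\<close> is, as a function of \<open>t\<close>, the one-dimensional transform of a function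
  of \<open>c\<close>, obtained by summing \<open>f\<close> times a character over the line \<open>dot v x = c\<close>. The uncertainty
  principle for the prime field applies to it.
\<close>
lemma fibre_bound:
  fixes f :: "'p::prime_card mod_ring \<times> 'p mod_ring \<Rightarrow> complex"
  assumes p: "CARD('p) > 2" and v: "v \<noteq> 0" and a: "plane_fourier f a \<noteq> 0"
  shows "CARD('p) + 1 \<le> card {b. plane_fourier f b \<noteq> 0 \<and> dot (rot v) b = dot (rot v) a}
    + card (dot v ` {x. f x \<noteq> 0})"
proof -
  define g where "g = (\<lambda>c. \<Sum>x | dot v x = c. f x * add_char (- dot a x))"
  define pt where "pt = (\<lambda>t. a - (t * fst v, t * snd v))"
  have pt: "plane_fourier f (pt t) = (\<Sum>c\<in>UNIV. g c * add_char (t * c))" for t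
  proof -
    have "plane_fourier f (pt t) = (\<Sum>x\<in>UNIV. f x * add_char (- dot a x) * add_char (t * dot v x))"
      unfolding plane_fourier_def
      by (intro sum.cong refl) (simp add: pt_def dot_def algebra_simps flip: add_char_add)
    also have "\<dots> = (\<Sum>c\<in>UNIV. \<Sum>x | dot v x = c. f x * add_char (- dot a x) * add_char (t * dot v x))"
      using sum.group[of UNIV UNIV "dot v" "\<lambda>x. f x * add_char (- dot a x) * add_char (t * dot v x)"]
      by simp
    also have "\<dots> = (\<Sum>c\<in>UNIV. g c * add_char (t * c))"
      unfolding g_def sum_distrib_right by (intro sum.cong refl) auto
    finally show ?thesis .
  qed
  have "\<exists>c. g c \<noteq> 0"
  proof (rule ccontr)
    assume "\<not> ?thesis"
    then have "plane_fourier f (pt 0) = 0" unfolding pt by simp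
    then show False using a by (simp add: pt_def zero_prod_def[symmetric])
  qed
  then obtain c where "g c \<noteq> 0" by blast
  then have "CARD('p) + 1 \<le> card {c. g c \<noteq> 0} + card {t. plane_fourier f (pt t) \<noteq> 0}"
    using uncertainty_prime_field[OF p, of g c] unfolding pt by simp
  also have "card {c. g c \<noteq> 0} \<le> card (dot v ` {x. f x \<noteq> 0})"
  proof (intro card_mono subsetI)
    fix c assume "c \<in> {c. g c \<noteq> 0}"
    then obtain x where "dot v x = c" "f x \<noteq> 0"
      unfolding g_def by (metis (mono_tags, lifting) mem_Collect_eq mult_eq_0_iff sum.neutral)
    then show "c \<in> dot v ` {x. f x \<noteq> 0}" by blast
  qed auto
  also have "card {t. plane_fourier f (pt t) \<noteq> 0} = card (pt ` {t. plane_fourier f (pt t) \<noteq> 0})"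
    using v by (intro card_image[symmetric]) (auto simp: inj_on_def pt_def prod_eq_iff)
  also have "\<dots> \<le> card {b. plane_fourier f b \<noteq> 0 \<and> dot (rot v) b = dot (rot v) a}"
    by (intro card_mono) (auto simp: pt_def dot_def rot_def algebra_simps)
  finally show ?thesis by simp
qed

lemma sum_add_char_dot:
  "(\<Sum>a\<in>UNIV. add_char (dot a y)) = (if y = 0 then of_nat (CARD('p) ^ 2) else 0)"
  for y :: "'p::prime_card mod_ring \<times> 'p mod_ring"
proof -
  have "(\<Sum>a\<in>UNIV. add_char (dot a y)) = (\<Sum>s\<in>UNIV. \<Sum>t\<in>UNIV. add_char (s * fst y) * add_char (t * snd y))"
    by (simp add: sum.cartesian_product case_prod_beta dot_def add_char_add)
  also have "\<dots> = (\<Sum>s\<in>UNIV. add_char (s * fst y)) * (\<Sum>t\<in>UNIV. add_char (t * snd y))"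
    by (simp add: sum_product)
  finally show ?thesis by (auto simp: sum_add_char prod_eq_iff power2_eq_square)
qed

lemma plane_fourier_inversion:
  fixes f :: "'p::prime_card mod_ring \<times> 'p mod_ring \<Rightarrow> complex"
  shows "plane_fourier (plane_fourier f) x = of_nat (CARD('p) ^ 2) * f (- x)"
proof -
  have "plane_fourier (plane_fourier f) x
      = (\<Sum>a\<in>UNIV. \<Sum>y\<in>UNIV. f y * (add_char (- dot a y) * add_char (- dot x a)))"
    unfolding plane_fourier_def by (simp add: sum_distrib_right mult.assoc)
  also have "\<dots> = (\<Sum>y\<in>UNIV. \<Sum>a\<in>UNIV. f y * (add_char (- dot a y) * add_char (- dot x a)))"
    by (rule sum.swap)
  also have "\<dots> = (\<Sum>y\<in>UNIV. f y * (\<Sum>a\<in>UNIV. add_char (dot a (- x - y))))"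
    unfolding sum_distrib_left add_char_add[symmetric]
    by (intro sum.cong refl arg_cong2[of _ _ _ _ "(*)"] arg_cong[of _ _ add_char])
      (simp add: dot_def algebra_simps)
  also have "\<dots> = (\<Sum>y\<in>UNIV. if y = - x then of_nat (CARD('p) ^ 2) * f (- x) else 0)"
    unfolding sum_add_char_dot by (intro sum.cong refl) auto
  finally show ?thesis by simp
qed

text \<open>
  The same with \<open>f\<close> and its transform exchanged, by Fourier inversion.
\<close>
lemma dual_fibre_bound:
  fixes f :: "'p::prime_card mod_ring \<times> 'p mod_ring \<Rightarrow> complex"
  assumes p: "CARD('p) > 2" and v: "v \<noteq> 0" and x: "f x \<noteq> 0"
  shows "CARD('p) + 1 \<le> card {y. f y \<noteq> 0 \<and> dot v y = dot v x}
    + card (dot (rot v) ` {a. plane_fourier f a \<noteq> 0})"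
proof -
  have "CARD('p) + 1 \<le> card {b. plane_fourier (plane_fourier f) b \<noteq> 0 \<and>
        dot (rot (rot v)) b = dot (rot (rot v)) (- x)}
    + card (dot (rot v) ` {a. plane_fourier f a \<noteq> 0})"
    using p v x by (intro fibre_bound) (auto simp: rot_eq_0 plane_fourier_inversion)
  also have "{b. plane_fourier (plane_fourier f) b \<noteq> 0 \<and> dot (rot (rot v)) b = dot (rot (rot v)) (- x)}
      = uminus ` {y. f y \<noteq> 0 \<and> dot v y = dot v x}"
  proof (intro equalityI subsetI)
    fix b assume "b \<in> {b. plane_fourier (plane_fourier f) b \<noteq> 0 \<and>
      dot (rot (rot v)) b = dot (rot (rot v)) (- x)}"
    then have "- b \<in> {y. f y \<noteq> 0 \<and> dot v y = dot v x}"
      by (auto simp: plane_fourier_inversion rot_rot dot_def algebra_simps)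
    then show "b \<in> uminus ` {y. f y \<noteq> 0 \<and> dot v y = dot v x}" by (intro image_eqI[of b uminus "- b"]) auto
  qed (auto simp: plane_fourier_inversion rot_rot dot_def algebra_simps)
  also have "card \<dots> = card {y. f y \<noteq> 0 \<and> dot v y = dot v x}"
    by (intro card_image) (auto simp: inj_on_def)
  finally show ?thesis .
qed

section \<open>The dual group in coordinates\<close>

text \<open>
  The identification of the plane with its dual group.
\<close>
definition plane_char :: "'p::prime_card mod_ring \<times> 'p mod_ring \<Rightarrow> 'p mod_ring \<times> 'p mod_ring \<Rightarrow> complex" where
  "plane_char a = (\<lambda>x. add_char (dot a x))"

lemma plane_char_in_dual: "plane_char a \<in> carrier dual_group"
  by (simp add: mem_dual_group_iff plane_char_def add_char_nonzero dot_add add_char_add)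

lemma inj_plane_char: "inj (plane_char :: 'p::prime_card mod_ring \<times> 'p mod_ring \<Rightarrow> _)"
proof (rule injI)
  fix a b :: "'p mod_ring \<times> 'p mod_ring"
  assume eq: "plane_char a = plane_char b"
  have "add_char (dot a x) = add_char (dot b x)" for x
    using fun_cong[OF eq, of x] by (simp add: plane_char_def)
  then have "add_char (dot a x - dot b x) = 1" for x
    by (metis add_char_add add_char_0 diff_conv_add_uminus add.right_inverse)
  then have "dot a x = dot b x" for x by (simp add: add_char_eq_1_iff)
  from this[of "(1, 0)"] this[of "(0, 1)"] show "a = b" by (simp add: dot_def prod_eq_iff)
qed

lemma field_character:
  fixes h :: "'p::prime_card mod_ring \<Rightarrow> complex"
  assumes nz: "h 0 \<noteq> 0" and add: "\<And>x y. h (x + y) = h x * h y"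
  shows "\<exists>a. \<forall>x. h x = add_char (a * x)"
proof -
  have h0: "h 0 = 1" using nz add[of 0 0] by simp
  have pow: "h (of_nat n) = h 1 ^ n" for n
    by (induction n) (simp_all add: h0 add)
  have "h 1 ^ CARD('p) = 1" using pow[of "CARD('p)"] h0 by simp
  then have "h 1 \<in> (\<lambda>k. cis (2 * pi * real k / real CARD('p))) ` {..<CARD('p)}"
    using bij_betw_roots_unity[of "CARD('p)"] by (simp add: bij_betw_def)
  then obtain k where "h 1 = root_of_unity CARD('p) ^ k"
    by (auto simp: root_of_unity_power)
  then have "h (of_nat n) = add_char (of_nat k * of_nat n :: 'p mod_ring)" for n
    by (simp add: pow add_char_of_nat flip: of_nat_mult power_mult)
  then show ?thesis by (metis of_nat_nat_to_int_mod_ring)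
qed

lemma dual_group_eq_range:
  "carrier dual_group = range (plane_char :: 'p::prime_card mod_ring \<times> 'p mod_ring \<Rightarrow> _)"
proof (intro equalityI subsetI)
  fix \<psi> :: "'p mod_ring \<times> 'p mod_ring \<Rightarrow> complex"
  assume "\<psi> \<in> carrier dual_group"
  then have \<psi>: "\<psi> x \<noteq> 0" "\<psi> (x + y) = \<psi> x * \<psi> y" for x y
    unfolding mem_dual_group_iff by blast+
  obtain a where a: "\<And>s. \<psi> (s, 0) = add_char (a * s)"
    using field_character[of "\<lambda>s. \<psi> (s, 0)"] \<psi>(1) \<psi>(2)[of "(_, 0)" "(_, 0)"] by auto
  obtain b where b: "\<And>s. \<psi> (0, s) = add_char (b * s)"
    using field_character[of "\<lambda>s. \<psi> (0, s)"] \<psi>(1) \<psi>(2)[of "(0, _)" "(0, _)"] by auto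
  have "\<psi> x = plane_char (a, b) x" for x
    using \<psi>(2)[of "(fst x, 0)" "(0, snd x)"] by (simp add: a b plane_char_def dot_def add_char_add)
  then show "\<psi> \<in> range plane_char" by blast
qed (auto intro: plane_char_in_dual)

lemma fourier_plane_char:
  fixes f :: "'p::prime_card mod_ring \<times> 'p mod_ring \<Rightarrow> complex"
  shows "fourier f (plane_char a) = plane_fourier f a / of_nat (CARD('p) ^ 2)"
  by (simp add: fourier_def plane_fourier_def plane_char_def cnj_add_char power2_eq_square)

lemma dot_eq_0_trans:
  assumes "v \<noteq> 0" "dot (rot v) a = 0" "dot v x = 0"
  shows "dot a x = 0"
proof -
  have a: "fst v * snd a = snd v * fst a" using assms(2) by (simp add: dot_def rot_def)
  have x: "fst v * fst x = - (snd v * snd x)" using assms(3) by (simp add: dot_def add_eq_0_iff2)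
  have "fst v * dot a x = fst a * (fst v * fst x) + (fst v * snd a) * snd x"
    by (simp add: dot_def algebra_simps)
  also have "\<dots> = 0" unfolding a x by (simp add: algebra_simps)
  finally have 1: "fst v * dot a x = 0" .
  have "snd v * dot a x = (snd v * fst a) * fst x + snd a * (snd v * snd x)"
    by (simp add: dot_def algebra_simps)
  also have "\<dots> = snd a * (fst v * fst x + snd v * snd x)"
    unfolding a[symmetric] by (simp add: algebra_simps)
  also have "\<dots> = 0" using assms(3) by (simp add: dot_def)
  finally have 2: "snd v * dot a x = 0" .
  show ?thesis using 1 2 assms(1) by (auto simp: prod_eq_iff)
qed

text \<open>
  Under the identification of the plane with its dual, the annihilator of a line through the origin is the line
  through the origin orthogonal to it.
\<close>
lemma perp_line:
  fixes v :: "'p::prime_card mod_ring \<times> 'p mod_ring"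
  assumes "v \<noteq> 0"
  shows "perp {x. dot v x = 0} = plane_char ` {a. dot (rot v) a = 0}"
proof (intro equalityI subsetI)
  fix \<psi> assume \<psi>: "\<psi> \<in> perp {x. dot v x = 0}"
  then obtain a where a: "\<psi> = plane_char a"
    by (auto simp: mem_perp_iff dual_group_eq_range)
  have "dot v (rot v) = 0" by (simp add: dot_rot dot_commute[of v])
  then have "plane_char a (rot v) = 1" using \<psi> unfolding a mem_perp_iff by blast
  then have "dot (rot v) a = 0" by (simp add: plane_char_def add_char_eq_1_iff dot_commute)
  then show "\<psi> \<in> plane_char ` {a. dot (rot v) a = 0}" using a by blast
next
  fix \<psi> assume "\<psi> \<in> plane_char ` {a. dot (rot v) a = 0}"
  then obtain a where a: "\<psi> = plane_char a" "dot (rot v) a = 0" by blast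
  then have "\<psi> x = 1" if "dot v x = 0" for x
    using dot_eq_0_trans[OF assms a(2) that] by (simp add: plane_char_def add_char_0)
  then show "\<psi> \<in> perp {x. dot v x = 0}"
    using plane_char_in_dual[of a] unfolding mem_perp_iff a(1) by blast
qed

lemma dual_perp_line:
  fixes v :: "'p::prime_card mod_ring \<times> 'p mod_ring"
  assumes "v \<noteq> 0"
  shows "dual_perp (plane_char ` {a. dot v a = 0}) = {x. dot (rot v) x = 0}"
proof (intro equalityI subsetI)
  fix x assume "x \<in> dual_perp (plane_char ` {a. dot v a = 0})"
  moreover have "plane_char (rot v) \<in> plane_char ` {a. dot v a = 0}"
    by (simp add: dot_rot dot_commute[of v])
  ultimately have "x \<in> kernel additive_group complex_units (plane_char (rot v))"
    unfolding dual_perp_def by blast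
  then have "plane_char (rot v) x = 1"
    by (simp add: kernel_def complex_units_def)
  then show "x \<in> {x. dot (rot v) x = 0}" by (simp add: plane_char_def add_char_eq_1_iff)
next
  fix x assume "x \<in> {x. dot (rot v) x = 0}"
  then have "dot x a = 0" if "dot v a = 0" for a
    using dot_eq_0_trans[OF assms _ that] by simp
  then show "x \<in> dual_perp (plane_char ` {a. dot v a = 0})"
    by (auto simp: dual_perp_def kernel_def complex_units_def additive_group_def plane_char_def
        add_char_0 dot_commute[of _ x])
qed

section \<open>Cosets of lines\<close>

lemma dot_surj:
  fixes v :: "'p::prime_card mod_ring \<times> 'p mod_ring"
  assumes "v \<noteq> 0" shows "\<exists>x. dot v x = c"
proof (rule ccontr)
  assume "\<not> ?thesis"
  then have "{x. dot v x = c} = {}" by blast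
  then show False using line_card[OF assms, of c] by (metis card.empty less_irrefl zero_less_card_finite)
qed

lemma coset_line:
  fixes v :: "'p::prime_card mod_ring \<times> 'p mod_ring"
  assumes "v \<noteq> 0"
  shows "{x. dot v x = c} \<in> rcosets\<^bsub>additive_group\<^esub> {x. dot v x = 0}"
proof -
  obtain y where y: "dot v y = c" using dot_surj[OF assms] by blast
  have "{x. dot v x = c} = {x. dot v x = 0} #>\<^bsub>additive_group\<^esub> y"
  proof (intro equalityI subsetI)
    fix x assume "x \<in> {x. dot v x = c}"
    then have "x = (x - y) + y" "dot v (x - y) = 0" using y by (simp_all add: dot_diff)
    then show "x \<in> {x. dot v x = 0} #>\<^bsub>additive_group\<^esub> y"
      unfolding r_coset_def additive_group_def by fastforce
  qed (auto simp: r_coset_def additive_group_def dot_add y)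
  moreover have "y \<in> carrier additive_group" by (simp add: additive_group_def)
  ultimately show ?thesis unfolding RCOSETS_def by blast
qed

lemma coset_dual_line:
  fixes v :: "'p::prime_card mod_ring \<times> 'p mod_ring"
  assumes "v \<noteq> 0"
  shows "plane_char ` {a. dot v a = c} \<in> rcosets\<^bsub>dual_group\<^esub> (plane_char ` {a. dot v a = 0})"
proof -
  have add: "plane_char (a + b) = (\<lambda>x. plane_char a x * plane_char b x)" for a b :: "'p mod_ring \<times> 'p mod_ring"
    by (simp add: plane_char_def dot_add_left add_char_add)
  obtain y where y: "dot v y = c" using dot_surj[OF assms] by blast
  have "plane_char ` {a. dot v a = c} = plane_char ` {a. dot v a = 0} #>\<^bsub>dual_group\<^esub> plane_char y"
  proof (intro equalityI subsetI)
    fix \<psi> assume "\<psi> \<in> plane_char ` {a. dot v a = c}"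
    then obtain x where x: "\<psi> = plane_char x" "dot v x = c" by blast
    then have "\<psi> = (\<lambda>z. plane_char (x - y) z * plane_char y z)" "dot v (x - y) = 0"
      using y by (simp_all add: dot_diff flip: add)
    then show "\<psi> \<in> plane_char ` {a. dot v a = 0} #>\<^bsub>dual_group\<^esub> plane_char y"
      unfolding r_coset_def mult_dual_group by blast
  qed (auto simp: r_coset_def dot_add y simp flip: add)
  then show ?thesis using plane_char_in_dual[of y] unfolding RCOSETS_def by auto
qed

lemma one_or_two_cosets_lines:
  assumes coset: "\<And>c. P c \<in> rcosets\<^bsub>G\<^esub> H" and inj: "inj P" and C: "card C = 1 \<or> card C = 2"
  shows "one_or_two_cosets G H (\<Union>c\<in>C. P c)"
  using C
proof
  assume "card C = 1"
  then obtain c where "C = {c}" by (auto simp: card_1_singleton_iff)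
  then show ?thesis using coset by (simp add: one_or_two_cosets_def)
next
  assume "card C = 2"
  then obtain c d where cd: "C = {c, d}" "c \<noteq> d" by (auto simp: card_2_iff)
  then have "P c \<noteq> P d" using inj by (auto dest: injD)
  then show ?thesis using coset cd by (auto simp: one_or_two_cosets_def)
qed

lemma subset_with_one_missing:
  assumes "finite L" "A \<subseteq> L" "card A + 1 \<ge> card L"
  shows "A = L \<or> (\<exists>c\<in>L. A = L - {c})"
proof (cases "A = L")
  case False
  then obtain c where c: "c \<in> L" "c \<notin> A" using assms(2) by blast
  then have "A = L - {c}"
    using assms by (intro card_seteq) (auto simp: card_Diff_singleton)
  then show ?thesis using c by blast
qed simp

lemma line_nontrivial:
  assumes "v \<noteq> 0" shows "{x. dot v x = 0} \<noteq> {0}"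
proof -
  have "rot v \<in> {x. dot v x = 0}" by (simp add: dot_rot dot_commute[of v])
  then show ?thesis using assms rot_eq_0 by blast
qed

lemma inj_lines:
  fixes v :: "'p::prime_card mod_ring \<times> 'p mod_ring"
  assumes "v \<noteq> 0" shows "inj (\<lambda>c. {x. dot v x = c})"
proof (rule injI)
  fix c d assume eq: "{x. dot v x = c} = {x. dot v x = d}"
  obtain x where "dot v x = c" using dot_surj[OF assms] by blast
  then show "c = d" using eq by blast
qed

lemma subgroup_dual_line:
  fixes v :: "'p::prime_card mod_ring \<times> 'p mod_ring"
  assumes "v \<noteq> 0" shows "subgroup (plane_char ` {a. dot v a = 0}) dual_group"
proof -
  have "perp {x. dot (rot v) x = 0} = plane_char ` {a. dot v a = 0}"
    using assms by (subst perp_line) (auto simp: rot_eq_0 rot_rot dot_uminus)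
  then show ?thesis using subgroup_perp by metis
qed

lemma subgroup_line:
  fixes v :: "'p::prime_card mod_ring \<times> 'p mod_ring"
  assumes "v \<noteq> 0" shows "subgroup {x. dot v x = 0} additive_group"
proof -
  have "dual_perp (plane_char ` {x. dot (rot v) x = 0}) = {a. dot v a = 0}"
    using assms by (subst dual_perp_line) (auto simp: rot_eq_0 rot_rot dot_uminus)
  moreover have "plane_char ` {x. dot (rot v) x = 0} \<subseteq> carrier dual_group"
    using plane_char_in_dual by blast
  ultimately show ?thesis using subgroup_dual_perp by metis
qed

lemma line_exception:
  fixes S X :: "('p::prime_card mod_ring \<times> 'p mod_ring) set"
  assumes v: "v \<noteq> 0" and S: "S \<subseteq> {x. dot v x = c}" "card S \<ge> CARD('p) - 1"
    and C: "card C = 1 \<or> card C = 2" and X: "X = {a. dot (rot v) a \<in> C}"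
  shows "\<exists>H. subgroup H additive_group \<and> H \<noteq> {\<one>\<^bsub>additive_group\<^esub>} \<and>
      coset_upto_one_missing additive_group H S \<and> one_or_two_cosets dual_group (perp H) (plane_char ` X)"
proof (intro exI conjI)
  let ?H = "{x. dot v x = 0}"
  have rv: "rot v \<noteq> 0" using v by (simp add: rot_eq_0)
  show "subgroup ?H additive_group" by (rule subgroup_line[OF v])
  show "?H \<noteq> {\<one>\<^bsub>additive_group\<^esub>}" using line_nontrivial[OF v] by (simp add: additive_group_def)
  have "S = {x. dot v x = c} \<or> (\<exists>y\<in>{x. dot v x = c}. S = {x. dot v x = c} - {y})"
    using S line_card[OF v, of c] by (intro subset_with_one_missing) auto
  then show "coset_upto_one_missing additive_group ?H S"
    unfolding coset_upto_one_missing_def by (intro bexI[OF _ coset_line[OF v, of c]])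
  have "one_or_two_cosets dual_group (plane_char ` {a. dot (rot v) a = 0})
      (\<Union>d\<in>C. plane_char ` {a. dot (rot v) a = d})"
    using C
  proof (rule one_or_two_cosets_lines[OF coset_dual_line[OF rv], rotated])
    show "inj (\<lambda>d. plane_char ` {a. dot (rot v) a = d})"
      using inj_lines[OF rv] unfolding inj_def inj_image_eq_iff[OF inj_plane_char] .
  qed
  also have "(\<Union>d\<in>C. plane_char ` {a. dot (rot v) a = d}) = plane_char ` X"
    unfolding X by auto
  finally show "one_or_two_cosets dual_group (perp ?H) (plane_char ` X)"
    unfolding perp_line[OF v] .
qed

lemma dual_line_exception:
  fixes S X :: "('p::prime_card mod_ring \<times> 'p mod_ring) set"
  assumes v: "v \<noteq> 0" and X: "X \<subseteq> {a. dot v a = c}" "card X \<ge> CARD('p) - 1"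
    and C: "card C = 1 \<or> card C = 2" and S: "S = {x. dot (rot v) x \<in> C}"
  shows "\<exists>F. subgroup F dual_group \<and> F \<noteq> {\<one>\<^bsub>dual_group\<^esub>} \<and>
      coset_upto_one_missing dual_group F (plane_char ` X) \<and> one_or_two_cosets additive_group (dual_perp F) S"
proof (intro exI conjI)
  let ?F = "plane_char ` {a. dot v a = 0}"
  have rv: "rot v \<noteq> 0" using v by (simp add: rot_eq_0)
  show "subgroup ?F dual_group" by (rule subgroup_dual_line[OF v])
  have "{\<one>\<^bsub>dual_group\<^esub>} = plane_char ` {0 :: 'p mod_ring \<times> 'p mod_ring}"
    by (simp add: plane_char_def dot_zero add_char_0)
  then show "?F \<noteq> {\<one>\<^bsub>dual_group\<^esub>}"
    using line_nontrivial[OF v] inj_image_eq_iff[OF inj_plane_char] by metis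
  have "X = {a. dot v a = c} \<or> (\<exists>y\<in>{a. dot v a = c}. X = {a. dot v a = c} - {y})"
    using X line_card[OF v, of c] by (intro subset_with_one_missing) auto
  then have "plane_char ` X = plane_char ` {a. dot v a = c} \<or>
      (\<exists>y\<in>plane_char ` {a. dot v a = c}. plane_char ` X = plane_char ` {a. dot v a = c} - {y})"
    by (auto simp: image_set_diff[OF inj_plane_char])
  then show "coset_upto_one_missing dual_group ?F (plane_char ` X)"
    unfolding coset_upto_one_missing_def by (intro bexI[OF _ coset_dual_line[OF v, of c]])
  have "one_or_two_cosets additive_group {x. dot (rot v) x = 0} (\<Union>d\<in>C. {x. dot (rot v) x = d})"
    by (rule one_or_two_cosets_lines[OF coset_line[OF rv] inj_lines[OF rv] C])
  also have "(\<Union>d\<in>C. {x. dot (rot v) x = d}) = S" unfolding S by auto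
  finally show "one_or_two_cosets additive_group (dual_perp ?F) S"
    unfolding dual_perp_line[OF v] .
qed

lemma card_dot_uminus: "card (dot (- v) ` T) = card (dot v ` T)"
proof -
  have "dot (- v) ` T = uminus ` dot v ` T" by (simp add: image_image dot_uminus)
  then show ?thesis by (simp add: card_image inj_on_def)
qed

section \<open>The uncertainty inequality\<close>

theorem corollary1:
  fixes p :: nat
    and f :: "'p::prime_card mod_ring \<times> 'p mod_ring \<Rightarrow> complex"
    and S :: "('p mod_ring \<times> 'p mod_ring) set"
    and X :: "('p mod_ring \<times> 'p mod_ring \<Rightarrow> complex) set"
  assumes "prime p" and "p > 3" and "CARD('p) = p"
    and "f \<noteq> (\<lambda>_. 0)"
    and "S = {g. f g \<noteq> 0}"
    and "X = {\<psi> \<in> carrier dual_group. fourier f \<psi> \<noteq> 0}"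
  shows "card S * card X \<ge> 3 * p * (p - 2)
    \<or> min (card S) (card X) \<le> 2
    \<or> card S \<le> card X \<and>
       (\<exists>H. subgroup H additive_group \<and> H \<noteq> {\<one>\<^bsub>additive_group\<^esub>} \<and>
         coset_upto_one_missing additive_group H S \<and> one_or_two_cosets dual_group (perp H) X)
    \<or> card X \<le> card S \<and>
       (\<exists>F. subgroup F dual_group \<and> F \<noteq> {\<one>\<^bsub>dual_group\<^esub>} \<and>
         coset_upto_one_missing dual_group F X \<and> one_or_two_cosets additive_group (dual_perp F) S)"
proof -
  define Y where "Y = {a. plane_fourier f a \<noteq> 0}"
  have X: "X = plane_char ` Y"
    using assms(6) by (auto simp: Y_def dual_group_eq_range fourier_plane_char)
  have cX: "card X = card Y"
    unfolding X using inj_plane_char inj_on_subset by (intro card_image) blast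
  have p: "CARD('p) > 2" "p = CARD('p)" using assms by auto
  have fibre_Y: "p + 1 \<le> card {b \<in> Y. dot (rot v) b = dot (rot v) a} + card (dot v ` S)"
    if "v \<noteq> 0" "a \<in> Y" for v a
    using fibre_bound[OF p(1) that(1), of f a] that assms(5) p(2) by (simp add: Y_def)
  have fibre_S: "p + 1 \<le> card {y \<in> S. dot v y = dot v x} + card (dot (rot v) ` Y)"
    if "v \<noteq> 0" "x \<in> S" for v x
    using dual_fibre_bound[OF p(1) that(1), of f x] that assms(5) p(2) by (simp add: Y_def)
  have "?thesis" if small: "card S * card Y < 3 * p * (p - 2)" and S3: "3 \<le> card S" and Y3: "3 \<le> card Y"
  proof (cases "card S \<le> card Y")
    case True
    interpret pair: uncertain_pair S Y p
      by (rule uncertain_pair.intro[OF p(2) assms(2) fibre_Y fibre_S S3 True small])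
    obtain v c C where *: "v \<noteq> 0" "S \<subseteq> {x. dot v x = c}" "card S \<ge> p - 1"
      "card C = 1 \<or> card C = 2" "Y = {a. dot (rot v) a \<in> C}"
      using pair.line_structure by blast
    show ?thesis
      using line_exception[OF *(1,2) *(3)[folded assms(3)] *(4,5), folded X] True cX by metis
  next
    case False
    have rot: "rot v \<noteq> 0" "- rot v \<noteq> 0" "rot (- rot v) = v"
      if "v \<noteq> 0" for v :: "'p mod_ring \<times> 'p mod_ring"
      using that by (auto simp: rot_def prod_eq_iff)
    \<comment> \<open>as \<open>rot (rot v) = - v\<close>, the hypotheses are symmetric in the two sets\<close>
    have fibre_S': "p + 1 \<le> card {b \<in> S. dot (rot v) b = dot (rot v) a} + card (dot v ` Y)"
      if "v \<noteq> 0" "a \<in> S" for v a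
      using fibre_S[OF rot(1)[OF that(1)] that(2)] by (simp add: rot_rot card_dot_uminus)
    have fibre_Y': "p + 1 \<le> card {y \<in> Y. dot v y = dot v a} + card (dot (rot v) ` S)"
      if "v \<noteq> 0" "a \<in> Y" for v a
      using fibre_Y[OF rot(2)[OF that(1)] that(2)]
      by (simp add: rot(3)[OF that(1)] card_dot_uminus)
    interpret pair: uncertain_pair Y S p
      using False small
      by (intro uncertain_pair.intro[OF p(2) assms(2) fibre_S' fibre_Y' Y3]) (simp_all add: mult.commute)
    obtain v c C where *: "v \<noteq> 0" "Y \<subseteq> {x. dot v x = c}" "card Y \<ge> p - 1"
      "card C = 1 \<or> card C = 2" "S = {a. dot (rot v) a \<in> C}"
      using pair.line_structure by blast
    show ?thesis
      using dual_line_exception[OF *(1,2) *(3)[folded assms(3)] *(4,5), folded X] False cX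
      by (metis nle_le)
  qed
  moreover have "3 \<le> card S" "3 \<le> card Y" if "\<not> min (card S) (card X) \<le> 2"
    using that unfolding cX by auto
  ultimately show ?thesis unfolding cX by (metis not_less)
qed

end
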